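(* Let $(M,D,g,f)$ be a compact gradient Hesse soliton, i.e. a compact Hessian manifold with a smooth function $f$ on $M$ and $\lambda\in\mathbb{R}$ such that $\beta-\nabla\nabla f=\lambda g$. If the soliton is non trivial (i.e. $(M,D,g)$ is not Hesse-Einstein), then it is proper, i.e. $D\neq\nabla$.
   Context: All manifolds are smooth, without boundary. A connection $D$ on $TM$ is flat if it is torsion free and its curvature tensor vanishes. A Hessian manifold $(M,D,g)$ is a manifold $M$ with a flat connection $D$ and a Riemannian metric $g$ that is locally of the form $g=Dd\varphi$ for a smooth function $\varphi$, i.e. $g_{ij}=\partial_i\partial_j\varphi$ in affine coordinates (local coordinates with $D_{\partial_i}\partial_j=0$). $\nabla$ denotes the Levi-Civita connection of $g$, and $\nabla\nabla f$ the Hessian of $f$ with respect to $\nabla$. With $v_g$ the (local) volume form of $g$, the first Koszul form $\alpha$ and second Koszul form $\beta$ are defined by $D_Xv_g=\alpha(X)v_g$ and $\beta=D\alpha$. A Hessian manifold is proper if $D\neq\nabla$. It is Hesse-Einstein if $\beta=\lambda g$ for some constant $\lambda\in\mathbb{R}$. A Hesse soliton is called trivial if it is Hesse-Einstein. *)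

theory Defs
  imports "HOL-Analysis.Analysis"
begin

section \<open>Smooth functions and smooth manifolds\<close>

text \<open>
  Being of class $C^k$ on an open subset of a Euclidean space. For open sets and finite dimension,
  the recursive clause is equivalent to all first partial derivatives being of class $C^k$.
\<close>

primrec Ck_on :: "nat \<Rightarrow> 'e::euclidean_space set \<Rightarrow> ('e \<Rightarrow> 'b::real_normed_vector) \<Rightarrow> bool" where
  "Ck_on 0 S f \<longleftrightarrow> continuous_on S f"
| "Ck_on (Suc k) S f \<longleftrightarrow>
     (\<forall>x\<in>S. f differentiable (at x)) \<and> (\<forall>v. Ck_on k S (\<lambda>x. frechet_derivative f (at x) v))"

definition smooth_on :: "'e::euclidean_space set \<Rightarrow> ('e \<Rightarrow> 'b::real_normed_vector) \<Rightarrow> bool" where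
  "smooth_on S f \<longleftrightarrow> (\<forall>k. Ck_on k S f)"

text \<open>
  The underlying set of a manifold is a whole (Hausdorff, second countable) type \<open>'a\<close>. A chart is
  a pair of its domain and the coordinate map, whose values outside the domain are irrelevant.
  The atlas need not be maximal; it stands for the smooth structure it generates.
\<close>

type_synonym ('a, 'n) atlas = "('a set \<times> ('a \<Rightarrow> real ^ 'n)) set"

definition chart :: "'a::topological_space set \<Rightarrow> ('a \<Rightarrow> real ^ 'n::finite) \<Rightarrow> bool" where
  "chart U c \<longleftrightarrow> open U \<and> open (c ` U) \<and> homeomorphism U (c ` U) c (inv_into U c)"

definition smooth_manifold ::
    "('a::{t2_space,second_countable_topology}, 'n::finite) atlas \<Rightarrow> bool" where
  "smooth_manifold A \<longleftrightarrow>
     (\<forall>(U, c)\<in>A. chart U c) \<and> (\<Union>(U, c)\<in>A. U) = UNIV \<and>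
     (\<forall>(U, c)\<in>A. \<forall>(V, d)\<in>A. smooth_on (c ` (U \<inter> V)) (d \<circ> inv_into U c))"

definition smooth_fun ::
    "('a::topological_space, 'n::finite) atlas \<Rightarrow> 'a set \<Rightarrow> ('a \<Rightarrow> real) \<Rightarrow> bool" where
  "smooth_fun A W f \<longleftrightarrow> (\<forall>(U, c)\<in>A. smooth_on (c ` (U \<inter> W)) (f \<circ> inv_into U c))"

definition smooth_near ::
    "('a::topological_space, 'n::finite) atlas \<Rightarrow> 'a \<Rightarrow> ('a \<Rightarrow> real) \<Rightarrow> bool" where
  "smooth_near A p f \<longleftrightarrow> (\<exists>W. open W \<and> p \<in> W \<and> smooth_fun A W f)"


section \<open>Tangent vectors and vector fields\<close>

text \<open>
  A tangent vector at \<open>p\<close> is a derivation on germs of smooth functions at \<open>p\<close>. As HOL functions are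
  total, it is normalised to be $0$ on functions that are not smooth near \<open>p\<close>, so that equality of
  tangent vectors is equality of HOL functions and the zero vector is \<open>\<lambda>f. 0\<close>.
\<close>

type_synonym 'a tvec = "('a \<Rightarrow> real) \<Rightarrow> real"
type_synonym 'a vfield = "'a \<Rightarrow> 'a tvec"

definition tangent_space ::
    "('a::topological_space, 'n::finite) atlas \<Rightarrow> 'a \<Rightarrow> 'a tvec set" where
  "tangent_space A p = {v.
     (\<forall>f. \<not> smooth_near A p f \<longrightarrow> v f = 0) \<and>
     (\<forall>f h. smooth_near A p f \<and> smooth_near A p h \<and> (\<forall>\<^sub>F q in nhds p. f q = h q) \<longrightarrow> v f = v h) \<and>
     (\<forall>f h a b. smooth_near A p f \<and> smooth_near A p h \<longrightarrow>
        v (\<lambda>q. a * f q + b * h q) = a * v f + b * v h) \<and>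
     (\<forall>f h. smooth_near A p f \<and> smooth_near A p h \<longrightarrow>
        v (\<lambda>q. f q * h q) = v f * h p + f p * v h)}"

definition lincomb :: "real \<Rightarrow> 'a tvec \<Rightarrow> real \<Rightarrow> 'a tvec \<Rightarrow> 'a tvec" where
  "lincomb a u b v = (\<lambda>f. a * u f + b * v f)"

text \<open>
  Smooth vector fields on the open set \<open>U\<close>; their values outside \<open>U\<close> are unconstrained, so that
  restricting a field to a smaller open set leaves the HOL function unchanged.
  The function $Xf$ is \<open>\<lambda>q. X q f\<close>.
\<close>

definition vfields ::
    "('a::topological_space, 'n::finite) atlas \<Rightarrow> 'a set \<Rightarrow> 'a vfield set" where
  "vfields A U = {X. (\<forall>p\<in>U. X p \<in> tangent_space A p) \<and>
     (\<forall>W f. open W \<and> W \<subseteq> U \<and> smooth_fun A W f \<longrightarrow> smooth_fun A W (\<lambda>q. X q f))}"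

definition bracket ::
    "('a::topological_space, 'n::finite) atlas \<Rightarrow> 'a vfield \<Rightarrow> 'a vfield \<Rightarrow> 'a vfield" where
  "bracket A X Y = (\<lambda>p f. if smooth_near A p f
     then X p (\<lambda>q. Y q f) - Y p (\<lambda>q. X q f) else 0)"


section \<open>Connections\<close>

text \<open>
  A connection $(X,Y) \mapsto D_X Y$ on the tangent bundle acts on the smooth vector fields over
  every open set, compatibly with restriction.
\<close>

type_synonym 'a conn = "'a vfield \<Rightarrow> 'a vfield \<Rightarrow> 'a vfield"

definition connection ::
    "('a::topological_space, 'n::finite) atlas \<Rightarrow> 'a conn \<Rightarrow> bool" where
  "connection A D \<longleftrightarrow> (\<forall>U. open U \<longrightarrow>
     (\<forall>X\<in>vfields A U. \<forall>Y\<in>vfields A U. D X Y \<in> vfields A U) \<and>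
     (\<forall>X\<in>vfields A U. \<forall>Y\<in>vfields A U. \<forall>X'\<in>vfields A U. \<forall>Y'\<in>vfields A U.
        (\<forall>q\<in>U. X q = X' q \<and> Y q = Y' q) \<longrightarrow> (\<forall>p\<in>U. D X Y p = D X' Y' p)) \<and>
     (\<forall>X\<in>vfields A U. \<forall>X'\<in>vfields A U. \<forall>Y\<in>vfields A U. \<forall>f h. \<forall>p\<in>U.
        smooth_fun A U f \<and> smooth_fun A U h \<longrightarrow>
        D (\<lambda>q. lincomb (f q) (X q) (h q) (X' q)) Y p
          = lincomb (f p) (D X Y p) (h p) (D X' Y p)) \<and>
     (\<forall>X\<in>vfields A U. \<forall>Y\<in>vfields A U. \<forall>Y'\<in>vfields A U. \<forall>p\<in>U.
        D X (\<lambda>q. lincomb 1 (Y q) 1 (Y' q)) p = lincomb 1 (D X Y p) 1 (D X Y' p)) \<and>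
     (\<forall>X\<in>vfields A U. \<forall>Y\<in>vfields A U. \<forall>f. \<forall>p\<in>U. smooth_fun A U f \<longrightarrow>
        D X (\<lambda>q. lincomb (f q) (Y q) 0 (Y q)) p = lincomb (X p f) (Y p) (f p) (D X Y p)))"

text \<open>
  HOL functions representing the same connection may still differ on non-smooth arguments or
  outside the domain of a local field, hence connections are compared as follows.
\<close>

definition same_connection ::
    "('a::topological_space, 'n::finite) atlas \<Rightarrow> 'a conn \<Rightarrow> 'a conn \<Rightarrow> bool" where
  "same_connection A D D' \<longleftrightarrow>
     (\<forall>U. open U \<longrightarrow> (\<forall>X\<in>vfields A U. \<forall>Y\<in>vfields A U. \<forall>p\<in>U. D X Y p = D' X Y p))"

definition torsion_free ::
    "('a::topological_space, 'n::finite) atlas \<Rightarrow> 'a conn \<Rightarrow> bool" where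
  "torsion_free A D \<longleftrightarrow> (\<forall>U. open U \<longrightarrow> (\<forall>X\<in>vfields A U. \<forall>Y\<in>vfields A U. \<forall>p\<in>U. \<forall>f.
     D X Y p f - D Y X p f - bracket A X Y p f = 0))"

definition curvature ::
    "('a::topological_space, 'n::finite) atlas \<Rightarrow> 'a conn \<Rightarrow> 'a vfield \<Rightarrow> 'a vfield \<Rightarrow> 'a vfield \<Rightarrow> 'a vfield"
  where
  "curvature A D X Y Z =
     (\<lambda>p f. D X (D Y Z) p f - D Y (D X Z) p f - D (bracket A X Y) Z p f)"

definition flat_connection ::
    "('a::topological_space, 'n::finite) atlas \<Rightarrow> 'a conn \<Rightarrow> bool" where
  "flat_connection A D \<longleftrightarrow> connection A D \<and> torsion_free A D \<and>
     (\<forall>U. open U \<longrightarrow> (\<forall>X\<in>vfields A U. \<forall>Y\<in>vfields A U. \<forall>Z\<in>vfields A U. \<forall>p\<in>U. \<forall>f.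
        curvature A D X Y Z p f = 0))"


section \<open>One-forms and their covariant derivatives\<close>

type_synonym 'a oneform = "'a \<Rightarrow> 'a tvec \<Rightarrow> real"

definition one_form ::
    "('a::topological_space, 'n::finite) atlas \<Rightarrow> 'a oneform \<Rightarrow> bool" where
  "one_form A \<omega> \<longleftrightarrow>
     (\<forall>p. \<forall>u\<in>tangent_space A p. \<forall>v\<in>tangent_space A p. \<forall>a b.
        \<omega> p (lincomb a u b v) = a * \<omega> p u + b * \<omega> p v) \<and>
     (\<forall>U. open U \<longrightarrow> (\<forall>X\<in>vfields A U. smooth_fun A U (\<lambda>q. \<omega> q (X q))))"

definition differential :: "('a \<Rightarrow> real) \<Rightarrow> 'a oneform" where
  "differential f = (\<lambda>p v. v f)"

text \<open>$(D\omega)(X,Y) = X(\omega(Y)) - \omega(D_X Y)$\<close>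

definition cov_deriv_form :: "'a conn \<Rightarrow> 'a oneform \<Rightarrow> 'a vfield \<Rightarrow> 'a vfield \<Rightarrow> 'a \<Rightarrow> real" where
  "cov_deriv_form D \<omega> X Y = (\<lambda>p. X p (\<lambda>q. \<omega> q (Y q)) - \<omega> p (D X Y p))"

definition hess :: "'a conn \<Rightarrow> ('a \<Rightarrow> real) \<Rightarrow> 'a vfield \<Rightarrow> 'a vfield \<Rightarrow> 'a \<Rightarrow> real" where
  "hess D f = cov_deriv_form D (differential f)"

definition tensor2_eq_on :: "('a::topological_space, 'n::finite) atlas \<Rightarrow> 'a set \<Rightarrow>
    ('a vfield \<Rightarrow> 'a vfield \<Rightarrow> 'a \<Rightarrow> real) \<Rightarrow> ('a vfield \<Rightarrow> 'a vfield \<Rightarrow> 'a \<Rightarrow> real) \<Rightarrow> bool" where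
  "tensor2_eq_on A W S T \<longleftrightarrow>
     (\<forall>U. open U \<and> U \<subseteq> W \<longrightarrow> (\<forall>X\<in>vfields A U. \<forall>Y\<in>vfields A U. \<forall>p\<in>U. S X Y p = T X Y p))"


section \<open>Riemannian metrics and Hessian manifolds\<close>

type_synonym 'a metric_field = "'a \<Rightarrow> 'a tvec \<Rightarrow> 'a tvec \<Rightarrow> real"

definition riemannian_metric ::
    "('a::topological_space, 'n::finite) atlas \<Rightarrow> 'a metric_field \<Rightarrow> bool" where
  "riemannian_metric A g \<longleftrightarrow>
     (\<forall>p. \<forall>u\<in>tangent_space A p. \<forall>v\<in>tangent_space A p. g p u v = g p v u) \<and>
     (\<forall>p. \<forall>u\<in>tangent_space A p. \<forall>v\<in>tangent_space A p. \<forall>w\<in>tangent_space A p. \<forall>a b.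
        g p (lincomb a u b v) w = a * g p u w + b * g p v w) \<and>
     (\<forall>p. \<forall>u\<in>tangent_space A p. u \<noteq> (\<lambda>f. 0) \<longrightarrow> g p u u > 0) \<and>
     (\<forall>U. open U \<longrightarrow>
        (\<forall>X\<in>vfields A U. \<forall>Y\<in>vfields A U. smooth_fun A U (\<lambda>q. g q (X q) (Y q))))"

definition metric_tensor :: "'a metric_field \<Rightarrow> 'a vfield \<Rightarrow> 'a vfield \<Rightarrow> 'a \<Rightarrow> real" where
  "metric_tensor g X Y = (\<lambda>p. g p (X p) (Y p))"

definition levi_civita ::
    "('a::topological_space, 'n::finite) atlas \<Rightarrow> 'a metric_field \<Rightarrow> 'a conn \<Rightarrow> bool" where
  "levi_civita A g N \<longleftrightarrow> connection A N \<and> torsion_free A N \<and>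
     (\<forall>U. open U \<longrightarrow> (\<forall>X\<in>vfields A U. \<forall>Y\<in>vfields A U. \<forall>Z\<in>vfields A U. \<forall>p\<in>U.
        X p (\<lambda>q. g q (Y q) (Z q)) = g p (N X Y p) (Z p) + g p (Y p) (N X Z p)))"

text \<open>
  In affine coordinates ($D_{\partial_i}\partial_j = 0$) the condition $g = D d\varphi$ reads
  $g_{ij} = \partial_i \partial_j \varphi$.
\<close>

definition hessian_manifold :: "('a::{t2_space,second_countable_topology}, 'n::finite) atlas \<Rightarrow>
    'a conn \<Rightarrow> 'a metric_field \<Rightarrow> bool" where
  "hessian_manifold A D g \<longleftrightarrow>
     smooth_manifold A \<and> flat_connection A D \<and> riemannian_metric A g \<and>
     (\<forall>p. \<exists>W \<phi>. open W \<and> p \<in> W \<and> smooth_fun A W \<phi> \<and>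
        tensor2_eq_on A W (metric_tensor g) (cov_deriv_form D (differential \<phi>)))"

definition proper_hessian :: "('a::topological_space, 'n::finite) atlas \<Rightarrow> 'a conn \<Rightarrow> 'a conn \<Rightarrow> bool"
  where "proper_hessian A D N \<longleftrightarrow> \<not> same_connection A D N"


section \<open>Volume forms and Koszul forms\<close>

text \<open>
  The dimension is \<open>CARD('n)\<close>, so \<open>n\<close>-tuples of tangent vectors are indexed by the type \<open>'n\<close>.
\<close>

type_synonym ('a, 'n) topform = "'a \<Rightarrow> ('n \<Rightarrow> 'a tvec) \<Rightarrow> real"

definition top_form_on ::
    "('a::topological_space, 'n::finite) atlas \<Rightarrow> 'a set \<Rightarrow> ('a, 'n) topform \<Rightarrow> bool" where
  "top_form_on A W v \<longleftrightarrow>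
     (\<forall>p\<in>W. \<forall>E. (\<forall>i. E i \<in> tangent_space A p) \<longrightarrow>
        (\<forall>i. \<forall>u\<in>tangent_space A p. \<forall>w\<in>tangent_space A p. \<forall>a b.
           v p (E(i := lincomb a u b w)) = a * v p (E(i := u)) + b * v p (E(i := w))) \<and>
        (\<forall>i j. i \<noteq> j \<and> E i = E j \<longrightarrow> v p E = 0)) \<and>
     (\<forall>U Y. open U \<and> U \<subseteq> W \<and> (\<forall>i. Y i \<in> vfields A U) \<longrightarrow>
        smooth_fun A U (\<lambda>q. v q (\<lambda>i. Y i q)))"

text \<open>
  A local volume form of \<open>g\<close> takes the values $\pm 1$ on orthonormal bases; the sign amounts to a
  local orientation, and the Koszul form below does not depend on it.
\<close>

definition volume_form_on :: "('a::topological_space, 'n::finite) atlas \<Rightarrow>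
    'a metric_field \<Rightarrow> 'a set \<Rightarrow> ('a, 'n) topform \<Rightarrow> bool" where
  "volume_form_on A g W v \<longleftrightarrow> top_form_on A W v \<and>
     (\<forall>p\<in>W. \<forall>E. (\<forall>i. E i \<in> tangent_space A p) \<and>
        (\<forall>i j. g p (E i) (E j) = (if i = j then 1 else 0)) \<longrightarrow> \<bar>v p E\<bar> = 1)"

text \<open>$(D_X v)(Y_1,\dots,Y_n) = X(v(Y_1,\dots,Y_n)) - \sum_i v(Y_1,\dots,D_X Y_i,\dots,Y_n)$\<close>

definition cov_deriv_top ::
    "'a conn \<Rightarrow> ('a, 'n::finite) topform \<Rightarrow> 'a vfield \<Rightarrow> ('n \<Rightarrow> 'a vfield) \<Rightarrow> 'a \<Rightarrow> real" where
  "cov_deriv_top D v X Y = (\<lambda>p. X p (\<lambda>q. v q (\<lambda>i. Y i q))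
     - (\<Sum>i\<in>UNIV. v p ((\<lambda>j. Y j p)(i := D X (Y i) p))))"

text \<open>
  As local volume forms exist around every point and do not vanish, this determines \<open>\<alpha>\<close> uniquely
  on tangent vectors.
\<close>

definition first_koszul_form :: "('a::topological_space, 'n::finite) atlas \<Rightarrow>
    'a conn \<Rightarrow> 'a metric_field \<Rightarrow> 'a oneform \<Rightarrow> bool" where
  "first_koszul_form A D g \<alpha> \<longleftrightarrow> one_form A \<alpha> \<and>
     (\<forall>W v. open W \<and> volume_form_on A g W v \<longrightarrow>
        (\<forall>U X Y. open U \<and> U \<subseteq> W \<and> X \<in> vfields A U \<and> (\<forall>i. Y i \<in> vfields A U) \<longrightarrow>
           (\<forall>p\<in>U. cov_deriv_top D v X Y p = \<alpha> p (X p) * v p (\<lambda>i. Y i p))))"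

definition second_koszul_form ::
    "'a conn \<Rightarrow> 'a oneform \<Rightarrow> 'a vfield \<Rightarrow> 'a vfield \<Rightarrow> 'a \<Rightarrow> real" where
  "second_koszul_form D \<alpha> = cov_deriv_form D \<alpha>"


section \<open>Hesse-Einstein manifolds and gradient Hesse solitons\<close>

text \<open>Here \<open>\<alpha>\<close> is meant to be the first Koszul form and \<open>N\<close> the Levi-Civita connection of \<open>g\<close>.\<close>

definition hesse_einstein :: "('a::topological_space, 'n::finite) atlas \<Rightarrow>
    'a conn \<Rightarrow> 'a metric_field \<Rightarrow> 'a oneform \<Rightarrow> bool" where
  "hesse_einstein A D g \<alpha> \<longleftrightarrow> (\<exists>c::real.
     tensor2_eq_on A UNIV (second_koszul_form D \<alpha>) (\<lambda>X Y p. c * metric_tensor g X Y p))"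

definition gradient_hesse_soliton :: "('a::{t2_space,second_countable_topology}, 'n::finite) atlas \<Rightarrow>
    'a conn \<Rightarrow> 'a metric_field \<Rightarrow> 'a conn \<Rightarrow> 'a oneform \<Rightarrow> ('a \<Rightarrow> real) \<Rightarrow> real \<Rightarrow> bool" where
  "gradient_hesse_soliton A D g N \<alpha> f l \<longleftrightarrow>
     hessian_manifold A D g \<and> smooth_fun A UNIV f \<and>
     tensor2_eq_on A UNIV (\<lambda>X Y p. second_koszul_form D \<alpha> X Y p - hess N f X Y p)
       (\<lambda>X Y p. l * metric_tensor g X Y p)"

end

(*
If D = nabla, then the first Koszul form vanishes on tangent vectors. Around each point Gram-Schmidt
gives a smooth orthonormal frame e, and v(E) = det (g(E_i, e_j)) is a local volume form with
v(e) = 1. Metric compatibility gives g(nabla_X e_i, e_i) = 0, hence (nabla_X v)(e) = 0 and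
alpha(X) = alpha(X) v(e) = (D_X v)(e) = 0. So beta = 0 = 0 g and the soliton is trivial.
That |v| = 1 on every orthonormal basis needs the tangent space to be spanned by the coordinate
fields, i.e. Hadamard's lemma for smooth functions.
*)

theory Submission
  imports Defs
begin

section \<open>Calculus of \<open>Ck_on\<close>\<close>

text \<open>\<open>first_koszul_form\<close> constrains \<alpha> only through local volume forms, so
  nothing can be read off at a point before one is exhibited there; this is why an explicit form is
  built. The difficulty is the condition |v E| = 1, which ranges over all orthonormal tuples of
  derivations. If every derivation is determined by its values on the coordinate functions, a tuple
  E becomes a square matrix M_E, and the Gram matrix between tuples E and F is M_E G M_F^T, with G
  the metric in coordinates. The condition is then pure determinant algebra. That a derivation is so
  determined is proved from f = f(q) + sum_i (x_i - x_i(q)) h_i. The h_i must be smooth to all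
  orders, because derivations see only smooth germs and the product rule has to apply to each term.
  They are integrals of partial derivatives along rays, hence the calculus of \<open>Ck_on\<close>
  up to differentiation under the integral sign. The vanishing of \<alpha> is needed along whole
  fields: \<beta>(X,Y) = X(\<alpha>(Y)) - \<alpha>(D_X Y) differentiates \<alpha>(Y).\<close>

lemma Ck_on_cong:
  assumes "open S" "Ck_on k S f" "\<And>x. x \<in> S \<Longrightarrow> f x = g x"
  shows "Ck_on k S g"
  using assms(2,3)
proof (induction k arbitrary: f g)
  case 0
  then show ?case by (simp cong: continuous_on_cong)
next
  case (Suc k)
  \<comment> \<open>Openness of S makes f and g agree on a neighbourhood of x, so their derivatives
    coincide although the functions may differ outside S.\<close>
  have eq: "frechet_derivative g (at x) = frechet_derivative f (at x)"
    and dif: "g differentiable (at x)" if x: "x \<in> S" for x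
  proof -
    have "(f has_derivative frechet_derivative f (at x)) (at x)"
      using Suc.prems(1) x frechet_derivative_works by auto
    then have "(g has_derivative frechet_derivative f (at x)) (at x)"
      by (rule has_derivative_transform_within_open[OF _ \<open>open S\<close> x]) (use Suc.prems(2) in auto)
    then show "frechet_derivative g (at x) = frechet_derivative f (at x)"
      "g differentiable (at x)"
      using frechet_derivative_at differentiable_def by metis+
  qed
  have "Ck_on k S (\<lambda>x. frechet_derivative g (at x) v)" for v
    by (rule Suc.IH[of "\<lambda>x. frechet_derivative f (at x) v"]) (use Suc.prems(1) eq in auto)
  then show ?case using dif by simp
qed

text \<open>By uniqueness of derivatives an explicit candidate \<open>f'\<close> may stand in for
  the chosen \<open>frechet_derivative\<close>. The closure rules below insert the usual
  differentiation formulas here.\<close>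

lemma Ck_on_SucI:
  assumes "\<And>x. x \<in> S \<Longrightarrow> (f has_derivative f' x) (at x)"
    and "\<And>v. Ck_on k S (\<lambda>x. f' x v)"
    and "open S"
  shows "Ck_on (Suc k) S f"
proof -
  have "f' x = frechet_derivative f (at x)" if "x \<in> S" for x
    using assms(1)[OF that] frechet_derivative_at by metis
  then have "Ck_on k S (\<lambda>x. frechet_derivative f (at x) v)" for v
    by (intro Ck_on_cong[OF assms(3) assms(2)[of v]]) simp
  moreover have "f differentiable (at x)" if "x \<in> S" for x
    using assms(1)[OF that] differentiable_def by blast
  ultimately show ?thesis by simp
qed

lemma Ck_on_SucD:
  assumes "Ck_on (Suc k) S f"
  shows "x \<in> S \<Longrightarrow> (f has_derivative frechet_derivative f (at x)) (at x)"
    and "Ck_on k S (\<lambda>x. frechet_derivative f (at x) v)"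
  using assms frechet_derivative_works by auto

lemma Ck_on_subset: "Ck_on k S f \<Longrightarrow> T \<subseteq> S \<Longrightarrow> Ck_on k T f"
  by (induction k arbitrary: f) (auto intro: continuous_on_subset)

text \<open>The recursion speaks of derivatives only, so the classes are not nested by definition.
  At the bottom, differentiability gives continuity; the inductive step applies the claim to the
  derivatives.\<close>

lemma Ck_on_Suc_imp: "Ck_on (Suc k) S f \<Longrightarrow> Ck_on k S f"
proof (induction k arbitrary: f)
  case 0
  then show ?case
    by (auto intro!: continuous_at_imp_continuous_on differentiable_imp_continuous_within)
next
  case (Suc k)
  have "Ck_on k S (\<lambda>x. frechet_derivative f (at x) v)" for v
    by (rule Suc.IH) (rule Suc.prems[unfolded Ck_on.simps(2)[of "Suc k"], THEN conjunct2, THEN spec])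
  then show ?case using Suc.prems by simp
qed

lemma Ck_on_const: "open S \<Longrightarrow> Ck_on k S (\<lambda>x. c)"
proof (induction k arbitrary: c)
  case (Suc k)
  show ?case by (rule Ck_on_SucI[where f' = "\<lambda>x v. 0"]) (use Suc in auto)
qed auto

lemma Ck_on_linear:
  assumes "bounded_linear h" "open S" "Ck_on k S f"
  shows "Ck_on k S (\<lambda>x. h (f x))"
  using assms(3)
proof (induction k arbitrary: f)
  case 0
  then show ?case
    using assms(1) bounded_linear.continuous_on by auto
next
  case (Suc k)
  show ?case
    by (rule Ck_on_SucI[where f' = "\<lambda>x v. h (frechet_derivative f (at x) v)"])
      (rule bounded_linear.has_derivative[OF assms(1)] Ck_on_SucD(1)[OF Suc.prems] Suc.IH
        Ck_on_SucD(2)[OF Suc.prems] assms(2) | assumption)+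
qed

lemma Ck_on_id: "open S \<Longrightarrow> Ck_on k S (\<lambda>x. x)"
proof (cases k)
  case (Suc k')
  assume S: "open S"
  show ?thesis unfolding Suc
    by (rule Ck_on_SucI[where f' = "\<lambda>x v. v"]) (use S in \<open>auto intro: Ck_on_const\<close>)
qed auto

lemma Ck_on_add:
  assumes "open S" "Ck_on k S f" "Ck_on k S g"
  shows "Ck_on k S (\<lambda>x. f x + g x)"
  using assms(2,3)
proof (induction k arbitrary: f g)
  case (Suc k)
  show ?case
    by (rule Ck_on_SucI[where
          f' = "\<lambda>x v. frechet_derivative f (at x) v + frechet_derivative g (at x) v"])
      (rule has_derivative_add Ck_on_SucD(1)[OF Suc.prems(1)] Ck_on_SucD(1)[OF Suc.prems(2)] Suc.IH
        Ck_on_SucD(2)[OF Suc.prems(1)] Ck_on_SucD(2)[OF Suc.prems(2)] assms(1) | assumption)+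
qed (auto intro!: continuous_intros)

text \<open>On the reals this is the ordinary product; the vector-valued version also serves the
  chain rule. The derivative contains f and g themselves, hence the use of
  \<open>Ck_on_Suc_imp\<close>.\<close>

lemma Ck_on_scaleR:
  assumes "open S" "Ck_on k S f" "Ck_on k S g"
  shows "Ck_on k S (\<lambda>x. f x *\<^sub>R g x)"
  using assms(2,3)
proof (induction k arbitrary: f g)
  case (Suc k)
  show ?case
  proof (rule Ck_on_SucI[where
        f' = "\<lambda>x v. f x *\<^sub>R frechet_derivative g (at x) v + frechet_derivative f (at x) v *\<^sub>R g x"])
    show "((\<lambda>x. f x *\<^sub>R g x) has_derivative
        (\<lambda>v. f x *\<^sub>R frechet_derivative g (at x) v + frechet_derivative f (at x) v *\<^sub>R g x)) (at x)"
      if "x \<in> S" for x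
      by (rule has_derivative_scaleR Ck_on_SucD(1)[OF Suc.prems(1) that]
          Ck_on_SucD(1)[OF Suc.prems(2) that])+
    show "Ck_on k S (\<lambda>x. f x *\<^sub>R frechet_derivative g (at x) v + frechet_derivative f (at x) v *\<^sub>R g x)"
      for v
      by (intro Ck_on_add[OF assms(1)] Suc.IH Ck_on_SucD(2)[OF Suc.prems(1)]
          Ck_on_SucD(2)[OF Suc.prems(2)] Ck_on_Suc_imp[OF Suc.prems(1)] Ck_on_Suc_imp[OF Suc.prems(2)])
  qed (rule assms(1))
qed (auto intro!: continuous_intros)

lemma Ck_on_sum:
  assumes "open S" "\<And>i. i \<in> I \<Longrightarrow> Ck_on k S (f i)"
  shows "Ck_on k S (\<lambda>x. \<Sum>i\<in>I. f i x)"
  using assms(2)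
  by (induction I rule: infinite_finite_induct)
    (auto intro: Ck_on_const Ck_on_add simp: assms(1))

lemma Ck_on_compose:
  fixes g :: "'a::euclidean_space \<Rightarrow> 'b::euclidean_space"
  assumes "open S" "open T" "Ck_on k S g" "Ck_on k T f" "\<And>x. x \<in> S \<Longrightarrow> g x \<in> T"
  shows "Ck_on k S (\<lambda>x. f (g x))"
  using assms(3,4)
proof (induction k arbitrary: f)
  case 0
  have "g ` S \<subseteq> T" using assms(5) by auto
  then show ?case using 0 continuous_on_compose2[of T f S g] by simp
next
  case (Suc k)
  let ?Df = "\<lambda>y. frechet_derivative f (at y)" and ?Dg = "\<lambda>x. frechet_derivative g (at x)"
  \<comment> \<open>In the chain rule the direction \<open>?Dg x v\<close> moves with x, whereas the
    recursion controls \<open>?Df\<close> only in fixed directions. Expanding the moving direction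
    in \<open>Basis\<close> separates the two dependences.\<close>
  show ?case
  proof (rule Ck_on_SucI[OF _ _ assms(1), where
        f' = "\<lambda>x v. \<Sum>b\<in>Basis. (?Dg x v \<bullet> b) *\<^sub>R ?Df (g x) b"])
    fix x assume x: "x \<in> S"
    have df: "(f has_derivative ?Df (g x)) (at (g x))" and dg: "(g has_derivative ?Dg x) (at x)"
      by (rule Ck_on_SucD(1)[OF Suc.prems(2) assms(5)[OF x]] Ck_on_SucD(1)[OF Suc.prems(1) x])+
    have expand: "?Df (g x) w = (\<Sum>b\<in>Basis. (w \<bullet> b) *\<^sub>R ?Df (g x) b)" for w
    proof -
      have lin: "linear (?Df (g x))" using df has_derivative_linear by blast
      have "?Df (g x) w = ?Df (g x) (\<Sum>b\<in>Basis. (w \<bullet> b) *\<^sub>R b)"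
        by (simp add: euclidean_representation)
      then show ?thesis by (simp add: linear_sum[OF lin] linear_cmul[OF lin])
    qed
    show "((\<lambda>x. f (g x)) has_derivative (\<lambda>v. \<Sum>b\<in>Basis. (?Dg x v \<bullet> b) *\<^sub>R ?Df (g x) b)) (at x)"
      by (rule has_derivative_eq_rhs[OF has_derivative_compose[OF dg df]]) (rule ext, rule expand)
  next
    fix v
    show "Ck_on k S (\<lambda>x. \<Sum>b\<in>Basis. (?Dg x v \<bullet> b) *\<^sub>R ?Df (g x) b)"
    proof (rule Ck_on_sum[OF assms(1)], rule Ck_on_scaleR[OF assms(1)])
      fix b :: 'b
      show "Ck_on k S (\<lambda>x. ?Dg x v \<bullet> b)"
        by (rule Ck_on_linear[OF bounded_linear_inner_left assms(1)]) (rule Ck_on_SucD(2)[OF Suc.prems(1)])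
      show "Ck_on k S (\<lambda>x. ?Df (g x) b)"
        by (rule Suc.IH) (rule Ck_on_Suc_imp[OF Suc.prems(1)] Ck_on_SucD(2)[OF Suc.prems(2)])+
    qed
  qed
qed

text \<open>Differentiation lowers the exponent, so the induction treats all r at once. The case r =
  -1/2 will normalise vectors in Gram-Schmidt.\<close>

lemma Ck_on_powr: "Ck_on k {0::real<..} (\<lambda>x. x powr r)"
proof (induction k arbitrary: r)
  case 0
  show ?case by (auto intro!: continuous_intros)
next
  case (Suc k)
  show ?case
  proof (rule Ck_on_SucI[where f' = "\<lambda>x v. (r * v) *\<^sub>R x powr (r - 1)"])
    show "((\<lambda>x. x powr r) has_derivative (\<lambda>v. (r * v) *\<^sub>R x powr (r - 1))) (at x)"
      if "x \<in> {0<..}" for x :: real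
      by (rule has_derivative_eq_rhs[OF has_real_derivative_powr[THEN has_field_derivative_imp_has_derivative]])
        (use that in \<open>auto simp: fun_eq_iff\<close>)
    show "Ck_on k {0<..} (\<lambda>x. (r * v) *\<^sub>R x powr (r - 1))" for v :: real
      by (rule Ck_on_scaleR[OF _ Ck_on_const Suc]) auto
  qed auto
qed

section \<open>Integrals along rays and Hadamard's lemma\<close>

lemma ray_in_ball:
  fixes x a :: "'a::real_normed_vector"
  assumes "x \<in> ball a r" "t \<in> {0..1}"
  shows "a + t *\<^sub>R (x - a) \<in> ball a r"
proof -
  have "\<bar>t\<bar> * norm (x - a) \<le> norm (x - a)" using assms by (auto intro: mult_left_le_one_le)
  then show ?thesis using assms by (simp add: dist_norm norm_minus_commute)
qed

lemma continuous_on_ray: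
  fixes a :: "'a::real_normed_vector"
  assumes "continuous_on (ball a r) \<phi>"
  shows "continuous_on (ball a r \<times> cbox 0 1) (\<lambda>z. \<phi> (a + snd z *\<^sub>R (fst z - a)))"
proof (rule continuous_on_compose2[OF assms])
  show "(\<lambda>z. a + snd z *\<^sub>R (fst z - a)) ` (ball a r \<times> cbox 0 1) \<subseteq> ball a r"
    using ray_in_ball[of _ a r] by auto
qed (auto intro!: continuous_intros)

lemma continuous_on_ray_fixed:
  fixes a :: "'a::real_normed_vector"
  assumes "x \<in> ball a r" "continuous_on (ball a r) \<phi>"
  shows "continuous_on (cbox 0 1) (\<lambda>t. \<phi> (a + t *\<^sub>R (x - a)))"
proof (rule continuous_on_compose2[OF assms(2)])
  show "(\<lambda>t. a + t *\<^sub>R (x - a)) ` cbox 0 1 \<subseteq> ball a r"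
    using ray_in_ball[OF assms(1)] by auto
qed (auto intro!: continuous_intros)

lemma Ck_on_le: "j \<le> k \<Longrightarrow> Ck_on k S f \<Longrightarrow> Ck_on j S f"
  by (induction k) (auto simp: le_Suc_eq simp del: Ck_on.simps dest: Ck_on_Suc_imp)

text \<open>
  The factor \<open>t ^ m\<close> makes the induction work: differentiating the integrand in \<open>x\<close> produces one
  more power of \<open>t\<close>.
\<close>

lemma Ck_on_ray_integral:
  fixes \<phi> :: "'a::euclidean_space \<Rightarrow> real"
  assumes "Ck_on k (ball a r) \<phi>"
  shows "Ck_on k (ball a r) (\<lambda>x. integral {0..1} (\<lambda>t. t ^ m * \<phi> (a + t *\<^sub>R (x - a))))"
  using assms
proof (induction k arbitrary: \<phi> m)
  case 0
  have "continuous_on (ball a r \<times> cbox 0 1) (\<lambda>(x, t). t ^ m * \<phi> (a + t *\<^sub>R (x - a)))"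
    unfolding split_beta
    by (intro continuous_on_mult continuous_on_ray) (use 0 in \<open>auto intro!: continuous_intros\<close>)
  then show ?case
    using integral_continuous_on_param[of "ball a r" 0 1 "\<lambda>x t. t ^ m * \<phi> (a + t *\<^sub>R (x - a))"]
    by simp
next
  case (Suc k)
  \<comment> \<open>\<open>leibniz_rule\<close> wants the derivative in x as a continuous family of
    bounded linear functions. L assembles it from the partial derivatives, whose continuity it
    inherits.\<close>
  define L where "L y = (\<Sum>b\<in>Basis. frechet_derivative \<phi> (at y) b *\<^sub>R blinfun_inner_left b)" for y
  have L: "blinfun_apply (L y) v = frechet_derivative \<phi> (at y) v" if "y \<in> ball a r" for y v
  proof -
    have lin: "linear (frechet_derivative \<phi> (at y))"
      using Ck_on_SucD(1)[OF Suc.prems that] has_derivative_linear by blast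
    have "frechet_derivative \<phi> (at y) v = frechet_derivative \<phi> (at y) (\<Sum>b\<in>Basis. (v \<bullet> b) *\<^sub>R b)"
      by (simp add: euclidean_representation)
    then show ?thesis
      by (simp add: L_def linear_sum[OF lin] linear_cmul[OF lin] blinfun.sum_left blinfun.scaleR_left
          inner_commute mult.commute)
  qed
  have cont_L: "continuous_on (ball a r) L"
    unfolding L_def
    using Ck_on_SucD(2)[OF Suc.prems] Ck_on_le[of 0 k]
    by (intro continuous_intros) auto
  let ?F = "\<lambda>x t. t ^ m * \<phi> (a + t *\<^sub>R (x - a))"
  let ?F' = "\<lambda>x t. (t ^ Suc m) *\<^sub>R L (a + t *\<^sub>R (x - a))"
  have cont_F': "continuous_on (ball a r \<times> cbox 0 1) (\<lambda>(x, t). ?F' x t)"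
    unfolding split_beta
    by (intro continuous_on_scaleR continuous_on_ray cont_L continuous_intros)
  have "continuous_on (ball a r) \<phi>"
    using Ck_on_le[OF _ Suc.prems, of 0] by simp
  then have int_F: "?F x integrable_on cbox 0 1" if "x \<in> ball a r" for x
    by (intro integrable_continuous continuous_on_mult continuous_on_ray_fixed[OF that] continuous_intros)
  have int_F': "?F' x integrable_on cbox 0 1" if "x \<in> ball a r" for x
    by (intro integrable_continuous continuous_on_scaleR continuous_on_ray_fixed[OF that] cont_L
        continuous_intros)
  show ?case
  proof (rule Ck_on_SucI)
    fix x assume x: "x \<in> ball a r"
    have deriv: "((\<lambda>x. ?F x t) has_derivative blinfun_apply (?F' x t)) (at x within ball a r)"
      if x: "x \<in> ball a r" and t: "t \<in> cbox (0::real) 1" for x t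
    proof -
      have y: "a + t *\<^sub>R (x - a) \<in> ball a r" using ray_in_ball x t by auto
      have "((\<lambda>x. \<phi> (a + t *\<^sub>R (x - a))) has_derivative
          (\<lambda>v. frechet_derivative \<phi> (at (a + t *\<^sub>R (x - a))) (t *\<^sub>R v))) (at x)"
        by (rule has_derivative_compose[where f = "\<lambda>x. a + t *\<^sub>R (x - a)" and g = \<phi>,
              OF _ Ck_on_SucD(1)[OF Suc.prems y]])
          (auto intro!: derivative_eq_intros)
      from has_derivative_mult_right[OF this, of "t ^ m"]
      have "((\<lambda>x. ?F x t) has_derivative
          (\<lambda>v. t ^ m * frechet_derivative \<phi> (at (a + t *\<^sub>R (x - a))) (t *\<^sub>R v))) (at x)" .
      moreover have "blinfun_apply (?F' x t) =
          (\<lambda>v. t ^ m * frechet_derivative \<phi> (at (a + t *\<^sub>R (x - a))) (t *\<^sub>R v))"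
        unfolding L[OF y, symmetric] by (simp add: fun_eq_iff blinfun.scaleR_left blinfun.scaleR_right)
      ultimately show ?thesis using has_derivative_at_withinI by metis
    qed
    have "((\<lambda>x. integral (cbox 0 1) (?F x)) has_derivative integral (cbox 0 1) (?F' x))
        (at x within ball a r)"
      by (rule leibniz_rule[of "ball a r" 0 1 ?F ?F', OF deriv int_F cont_F' x convex_ball])
    then show "((\<lambda>x. integral {0..1} (?F x)) has_derivative integral (cbox 0 1) (?F' x)) (at x)"
      unfolding at_within_open[OF x open_ball] cbox_interval .
  next
    fix v
    \<comment> \<open>Evaluation at v is bounded linear and passes through the integral. What
      remains is a ray integral of a directional derivative with weight \<open>t ^ Suc m\<close>,
      the shape of the induction hypothesis.\<close>
    have eq: "integral {0..1} (\<lambda>t. t ^ Suc m * frechet_derivative \<phi> (at (a + t *\<^sub>R (x - a))) v)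
       = blinfun_apply (integral (cbox 0 1) (?F' x)) v" if x: "x \<in> ball a r" for x
    proof -
      have "blinfun_apply (integral (cbox 0 1) (?F' x)) v = integral (cbox 0 1) (\<lambda>t. ?F' x t v)"
        using integral_linear[OF int_F'[OF x] blinfun.bounded_linear_left, of v] by (simp add: o_def)
      also have "\<dots> = integral {0..1} (\<lambda>t. t ^ Suc m * frechet_derivative \<phi> (at (a + t *\<^sub>R (x - a))) v)"
        unfolding cbox_interval
        by (rule integral_cong) (use L[OF ray_in_ball[OF x], of _ v] in \<open>simp add: blinfun.scaleR_left\<close>)
      finally show ?thesis by simp
    qed
    show "Ck_on k (ball a r) (\<lambda>x. blinfun_apply (integral (cbox 0 1) (?F' x)) v)"
      by (rule Ck_on_cong[OF open_ball Suc.IH[OF Ck_on_SucD(2)[OF Suc.prems]] eq])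
  qed (rule open_ball)
qed


lemma smooth_on_subset: "smooth_on S f \<Longrightarrow> T \<subseteq> S \<Longrightarrow> smooth_on T f"
  unfolding smooth_on_def using Ck_on_subset by blast

lemma smooth_on_compose:
  fixes g :: "'a::euclidean_space \<Rightarrow> 'b::euclidean_space"
  shows "open S \<Longrightarrow> open T \<Longrightarrow> smooth_on S g \<Longrightarrow> smooth_on T f \<Longrightarrow> g ` S \<subseteq> T
    \<Longrightarrow> smooth_on S (f \<circ> g)"
  unfolding smooth_on_def comp_def by (metis Ck_on_compose image_subset_iff)

lemma smooth_on_deriv: "smooth_on S f \<Longrightarrow> smooth_on S (\<lambda>x. frechet_derivative f (at x) v)"
  unfolding smooth_on_def using Ck_on_SucD(2) by blast

lemma smooth_on_has_derivative:
  "smooth_on S f \<Longrightarrow> x \<in> S \<Longrightarrow> (f has_derivative frechet_derivative f (at x)) (at x)"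
  unfolding smooth_on_def using Ck_on_SucD(1) by blast

lemma smooth_on_continuous: "smooth_on S f \<Longrightarrow> continuous_on S f"
  unfolding smooth_on_def using Ck_on.simps(1) by blast

text \<open>Integrate the derivative of \<phi> along the segment from a to x and collect the
  coefficient of each coordinate of x - a. Thus \<open>h b\<close> is the mean of the partial
  derivative in direction b over that segment; at a the integrand is constant.\<close>

lemma smooth_on_Hadamard:
  fixes \<phi> :: "'a::euclidean_space \<Rightarrow> real"
  assumes "smooth_on (ball a r) \<phi>" "r > 0"
  obtains h where "\<And>b. smooth_on (ball a r) (h b)"
    and "\<And>x. x \<in> ball a r \<Longrightarrow> \<phi> x = \<phi> a + (\<Sum>b\<in>Basis. ((x - a) \<bullet> b) * h b x)"
    and "\<And>b. h b a = frechet_derivative \<phi> (at a) b"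
proof
  let ?D = "\<lambda>x. frechet_derivative \<phi> (at x)"
  let ?h = "\<lambda>b x. integral {0..1} (\<lambda>t. ?D (a + t *\<^sub>R (x - a)) b)"
  show "smooth_on (ball a r) (?h b)" for b
    unfolding smooth_on_def
  proof
    fix k
    have "Ck_on k (ball a r) (\<lambda>x. ?D x b)"
      using smooth_on_deriv[OF assms(1)] by (simp add: smooth_on_def)
    from Ck_on_ray_integral[OF this, of 0] show "Ck_on k (ball a r) (?h b)" by simp
  qed
  show "?h b a = ?D a b" for b by simp
  fix x assume x: "x \<in> ball a r"
  have a: "a \<in> ball a r" using assms(2) by simp
  have "((\<lambda>t. ?D (a + t *\<^sub>R (x - a)) (x - a)) has_integral
      \<phi> (a + 1 *\<^sub>R (x - a)) - \<phi> (a + 0 *\<^sub>R (x - a))) {0..1}"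
  proof (rule fundamental_theorem_of_calculus)
    fix t :: real assume "t \<in> {0..1}"
    from smooth_on_has_derivative[OF assms(1) ray_in_ball[OF x this]]
    have d: "(\<phi> has_derivative ?D (a + t *\<^sub>R (x - a))) (at (a + t *\<^sub>R (x - a)))" .
    have "((\<lambda>t. \<phi> (a + t *\<^sub>R (x - a))) has_derivative (\<lambda>s. ?D (a + t *\<^sub>R (x - a)) (s *\<^sub>R (x - a)))) (at t)"
      by (rule has_derivative_compose[where f = "\<lambda>t. a + t *\<^sub>R (x - a)" and g = \<phi>, OF _ d])
        (auto intro!: derivative_eq_intros)
    then show "((\<lambda>t. \<phi> (a + t *\<^sub>R (x - a))) has_vector_derivative ?D (a + t *\<^sub>R (x - a)) (x - a))
        (at t within {0..1})"
      unfolding has_vector_derivative_def linear_cmul[OF has_derivative_linear[OF d]]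
      by (rule has_derivative_at_withinI)
  qed simp
  then have "\<phi> x - \<phi> a = integral {0..1} (\<lambda>t. ?D (a + t *\<^sub>R (x - a)) (x - a))"
    by (simp add: integral_unique)
  also have "\<dots> = integral {0..1} (\<lambda>t. \<Sum>b\<in>Basis. ((x - a) \<bullet> b) * ?D (a + t *\<^sub>R (x - a)) b)"
  proof (rule integral_cong)
    fix t :: real assume "t \<in> {0..1}"
    from smooth_on_has_derivative[OF assms(1) ray_in_ball[OF x this]]
    have lin: "linear (?D (a + t *\<^sub>R (x - a)))" by (rule has_derivative_linear)
    have "?D (a + t *\<^sub>R (x - a)) (x - a)
        = ?D (a + t *\<^sub>R (x - a)) (\<Sum>b\<in>Basis. ((x - a) \<bullet> b) *\<^sub>R b)"
      by (simp only: euclidean_representation)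
    also have "\<dots> = (\<Sum>b\<in>Basis. ((x - a) \<bullet> b) * ?D (a + t *\<^sub>R (x - a)) b)"
      by (simp only: linear_sum[OF lin] linear_cmul[OF lin] real_scaleR_def)
    finally show "?D (a + t *\<^sub>R (x - a)) (x - a)
        = (\<Sum>b\<in>Basis. ((x - a) \<bullet> b) * ?D (a + t *\<^sub>R (x - a)) b)" .
  qed
  also have "\<dots> = (\<Sum>b\<in>Basis. integral {0..1} (\<lambda>t. ((x - a) \<bullet> b) * ?D (a + t *\<^sub>R (x - a)) b))"
  proof (rule integral_sum)
    fix b :: 'a
    have "continuous_on (ball a r) (\<lambda>y. ?D y b)"
      using smooth_on_deriv[OF assms(1)] by (rule smooth_on_continuous)
    from continuous_on_ray_fixed[OF x this]
    show "(\<lambda>t. ((x - a) \<bullet> b) * ?D (a + t *\<^sub>R (x - a)) b) integrable_on {0..1}"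
      by (intro integrable_continuous_interval continuous_on_mult continuous_on_const) simp
  qed simp
  also have "\<dots> = (\<Sum>b\<in>Basis. ((x - a) \<bullet> b) * ?h b x)" by simp
  finally show "\<phi> x = \<phi> a + (\<Sum>b\<in>Basis. ((x - a) \<bullet> b) * ?h b x)" by simp
qed


section \<open>Smooth functions on a manifold\<close>

lemma sum_Basis_axis:
  fixes F :: "real ^ 'n \<Rightarrow> real"
  shows "(\<Sum>b\<in>Basis. F b) = (\<Sum>i\<in>UNIV. F (axis i 1))"
proof -
  have eq: "(Basis :: (real ^ 'n) set) = range (\<lambda>i. axis i 1)"
    by (auto simp: Basis_vec_def)
  have "inj (\<lambda>i :: 'n. axis i (1 :: real))" by (auto simp: inj_on_def axis_eq_axis)
  then show ?thesis unfolding eq by (simp add: sum.reindex)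
qed

locale atlas_manifold =
  fixes A :: "('a::{t2_space,second_countable_topology}, 'n::finite) atlas"
  assumes manifold: "smooth_manifold A"
begin

lemma chart_inverse:
  assumes "(U, c) \<in> A"
  shows "q \<in> U \<Longrightarrow> inv_into U c (c q) = q"
    and "y \<in> c ` U \<Longrightarrow> c (inv_into U c y) = y"
    and "y \<in> c ` (U \<inter> W) \<Longrightarrow> inv_into U c y \<in> U \<inter> W"
proof -
  have hom: "homeomorphism U (c ` U) c (inv_into U c)"
    using manifold assms by (auto simp: smooth_manifold_def chart_def)
  show inv: "q \<in> U \<Longrightarrow> inv_into U c (c q) = q" for q using hom by (simp add: homeomorphism_def)
  show "y \<in> c ` U \<Longrightarrow> c (inv_into U c y) = y" by (rule f_inv_into_f)
  show "y \<in> c ` (U \<inter> W) \<Longrightarrow> inv_into U c y \<in> U \<inter> W" using inv by auto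
qed

lemma chart_open: "(U, c) \<in> A \<Longrightarrow> open U"
  using manifold by (auto simp: smooth_manifold_def chart_def)

lemma chart_continuous: "(U, c) \<in> A \<Longrightarrow> continuous_on U c"
  using manifold by (auto simp: smooth_manifold_def chart_def homeomorphism_def)

lemma chart_image_open:
  assumes "(U, c) \<in> A" "open W"
  shows "open (c ` (U \<inter> W))"
proof -
  have "homeomorphism U (c ` U) c (inv_into U c)" and op: "open (c ` U)"
    using manifold assms(1) by (auto simp: smooth_manifold_def chart_def)
  then have "openin (top_of_set (c ` U)) (c ` (U \<inter> W))"
    using homeomorphism_imp_open_map assms(2) openin_open by blast
  then show ?thesis using op openin_open_trans by blast
qed

lemma transition_smooth:
  "(U, c) \<in> A \<Longrightarrow> (V, d) \<in> A \<Longrightarrow> smooth_on (c ` (U \<inter> V)) (d \<circ> inv_into U c)"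
  using manifold by (fastforce simp: smooth_manifold_def)

lemma chart_around: obtains U c where "(U, c) \<in> A" "p \<in> U"
proof -
  have "p \<in> (\<Union>(U, c)\<in>A. U)" using manifold by (simp add: smooth_manifold_def)
  then show ?thesis using that by blast
qed

lemma smooth_funI:
  assumes "\<And>U c k. (U, c) \<in> A \<Longrightarrow> open (c ` (U \<inter> W)) \<Longrightarrow> Ck_on k (c ` (U \<inter> W)) (f \<circ> inv_into U c)"
    and "open W"
  shows "smooth_fun A W f"
  using assms chart_image_open unfolding smooth_fun_def smooth_on_def by blast

lemma smooth_funD: "smooth_fun A W f \<Longrightarrow> (U, c) \<in> A \<Longrightarrow> Ck_on k (c ` (U \<inter> W)) (f \<circ> inv_into U c)"
  unfolding smooth_fun_def smooth_on_def by blast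

lemma smooth_fun_subset: "smooth_fun A W f \<Longrightarrow> W' \<subseteq> W \<Longrightarrow> smooth_fun A W' f"
  unfolding smooth_fun_def by (blast intro: smooth_on_subset)

lemma smooth_fun_cong:
  assumes "open W" "smooth_fun A W f" "\<And>q. q \<in> W \<Longrightarrow> f q = h q"
  shows "smooth_fun A W h"
proof (rule smooth_funI[OF _ assms(1)])
  fix U c k assume U: "(U, c) \<in> A" and o: "open (c ` (U \<inter> W))"
  show "Ck_on k (c ` (U \<inter> W)) (h \<circ> inv_into U c)"
    by (rule Ck_on_cong[OF o smooth_funD[OF assms(2) U]])
      (use assms(3) chart_inverse(3)[OF U] in auto)
qed

lemma smooth_fun_const: "open W \<Longrightarrow> smooth_fun A W (\<lambda>q. k)"
  by (rule smooth_funI) (auto simp: comp_def intro: Ck_on_const)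

lemma smooth_fun_add:
  assumes "open W" "smooth_fun A W f" "smooth_fun A W h"
  shows "smooth_fun A W (\<lambda>q. f q + h q)"
proof (rule smooth_funI[OF _ assms(1)])
  fix U c k assume "(U, c) \<in> A" "open (c ` (U \<inter> W))"
  then show "Ck_on k (c ` (U \<inter> W)) ((\<lambda>q. f q + h q) \<circ> inv_into U c)"
    using Ck_on_add[OF _ smooth_funD[OF assms(2)] smooth_funD[OF assms(3)]] by (simp add: comp_def)
qed

lemma smooth_fun_mult:
  assumes "open W" "smooth_fun A W f" "smooth_fun A W h"
  shows "smooth_fun A W (\<lambda>q. f q * h q)"
proof (rule smooth_funI[OF _ assms(1)])
  fix U c k assume "(U, c) \<in> A" "open (c ` (U \<inter> W))"
  then show "Ck_on k (c ` (U \<inter> W)) ((\<lambda>q. f q * h q) \<circ> inv_into U c)"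
    using Ck_on_scaleR[OF _ smooth_funD[OF assms(2)] smooth_funD[OF assms(3)]] by (simp add: comp_def)
qed

lemma smooth_fun_sum:
  assumes "open W" "\<And>i. i \<in> I \<Longrightarrow> smooth_fun A W (f i)"
  shows "smooth_fun A W (\<lambda>q. \<Sum>i\<in>I. f i q)"
  using assms(2) by (induction I rule: infinite_finite_induct)
    (auto intro: smooth_fun_const[OF assms(1)] smooth_fun_add[OF assms(1)])

lemma smooth_fun_prod:
  assumes "open W" "\<And>i. i \<in> I \<Longrightarrow> smooth_fun A W (f i)"
  shows "smooth_fun A W (\<lambda>q. \<Prod>i\<in>I. f i q)"
  using assms(2) by (induction I rule: infinite_finite_induct)
    (auto intro: smooth_fun_const[OF assms(1)] smooth_fun_mult[OF assms(1)])

lemma smooth_fun_powr: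
  assumes "open W" "smooth_fun A W f" "\<And>q. q \<in> W \<Longrightarrow> f q > 0"
  shows "smooth_fun A W (\<lambda>q. f q powr r)"
proof (rule smooth_funI[OF _ assms(1)])
  fix U c k assume U: "(U, c) \<in> A" and o: "open (c ` (U \<inter> W))"
  have "Ck_on k (c ` (U \<inter> W)) (\<lambda>y. (f \<circ> inv_into U c) y powr r)"
    by (rule Ck_on_compose[OF o _ smooth_funD[OF assms(2) U] Ck_on_powr])
      (use assms(3) chart_inverse(3)[OF U] in auto)
  then show "Ck_on k (c ` (U \<inter> W)) ((\<lambda>q. f q powr r) \<circ> inv_into U c)"
    by (simp add: comp_def)
qed

text \<open>In any other chart the function is represented by F after a transition map, so
  smoothness in a single chart suffices.\<close>

lemma smooth_fun_chart_compose:
  assumes U: "(U, c) \<in> A" and W: "open W" "W \<subseteq> U" and F: "smooth_on (c ` W) F"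
  shows "smooth_fun A W (F \<circ> c)"
  unfolding smooth_fun_def
proof clarify
  fix V d assume V: "(V, d) \<in> A"
  have eq: "U \<inter> W = W" using W by blast
  have "smooth_on (d ` (V \<inter> W)) (F \<circ> (c \<circ> inv_into V d))"
  proof (rule smooth_on_compose[OF chart_image_open[OF V W(1)] _ _ F])
    show "open (c ` W)" using chart_image_open[OF U W(1)] eq by simp
    show "smooth_on (d ` (V \<inter> W)) (c \<circ> inv_into V d)"
      by (rule smooth_on_subset[OF transition_smooth[OF V U]]) (use W in auto)
    show "(c \<circ> inv_into V d) ` (d ` (V \<inter> W)) \<subseteq> c ` W"
      using chart_inverse(1)[OF V] by auto
  qed
  then show "smooth_on (d ` (V \<inter> W)) (F \<circ> c \<circ> inv_into V d)" by (simp add: comp_assoc)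
qed

lemma smooth_fun_coordinate:
  assumes "(U, c) \<in> A"
  shows "smooth_fun A U (\<lambda>q. c q $ i)"
proof -
  have "open (c ` U)" using chart_image_open[OF assms chart_open[OF assms]] by simp
  then have "smooth_on (c ` U) (\<lambda>y. y $ i)"
    unfolding smooth_on_def using Ck_on_linear[OF bounded_linear_vec_nth _ Ck_on_id] by blast
  from smooth_fun_chart_compose[OF assms chart_open[OF assms] order_refl this]
  show ?thesis by (simp add: comp_def)
qed

lemma smooth_nearI: "open W \<Longrightarrow> q \<in> W \<Longrightarrow> smooth_fun A W f \<Longrightarrow> smooth_near A q f"
  unfolding smooth_near_def by blast

lemma smooth_near_const: "smooth_near A q (\<lambda>p. k)"
  using smooth_nearI[OF open_UNIV UNIV_I smooth_fun_const[OF open_UNIV]] .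

lemma smooth_near_common:
  assumes "smooth_near A q f" "smooth_near A q h"
  obtains W where "open W" "q \<in> W" "smooth_fun A W f" "smooth_fun A W h"
proof -
  from assms obtain W W' where "open W" "q \<in> W" "smooth_fun A W f" "open W'" "q \<in> W'" "smooth_fun A W' h"
    unfolding smooth_near_def by blast
  then show ?thesis
    by (intro that[of "W \<inter> W'"]) (auto intro: smooth_fun_subset)
qed

lemma smooth_near_add:
  assumes "smooth_near A q f" "smooth_near A q h"
  shows "smooth_near A q (\<lambda>p. f p + h p)"
  using smooth_near_common[OF assms] smooth_fun_add smooth_nearI by metis

lemma smooth_near_mult:
  assumes "smooth_near A q f" "smooth_near A q h"
  shows "smooth_near A q (\<lambda>p. f p * h p)"
  using smooth_near_common[OF assms] smooth_fun_mult smooth_nearI by metis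

lemma smooth_near_sum:
  "(\<And>i. i \<in> I \<Longrightarrow> smooth_near A q (f i)) \<Longrightarrow> smooth_near A q (\<lambda>p. \<Sum>i\<in>I. f i p)"
  by (induction I rule: infinite_finite_induct) (auto intro: smooth_near_const smooth_near_add)


section \<open>Tangent vectors\<close>

lemma tangent_nonsmooth: "v \<in> tangent_space A q \<Longrightarrow> \<not> smooth_near A q f \<Longrightarrow> v f = 0"
  by (simp add: tangent_space_def)

lemma tangent_lin:
  "v \<in> tangent_space A q \<Longrightarrow> smooth_near A q f \<Longrightarrow> smooth_near A q h \<Longrightarrow>
    v (\<lambda>p. a * f p + b * h p) = a * v f + b * v h"
  unfolding tangent_space_def by blast

lemma tangent_mult:
  "v \<in> tangent_space A q \<Longrightarrow> smooth_near A q f \<Longrightarrow> smooth_near A q h \<Longrightarrow>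
    v (\<lambda>p. f p * h p) = v f * h q + f q * v h"
  unfolding tangent_space_def by blast

text \<open>Agreement on W makes h smooth near q as well. This matters because tangent vectors are
  normalised to 0 on functions that are not smooth near q.\<close>

lemma tangent_cong_open:
  assumes "v \<in> tangent_space A q" "open W" "q \<in> W" "smooth_fun A W f" "\<And>p. p \<in> W \<Longrightarrow> f p = h p"
  shows "v f = v h"
proof -
  have "smooth_near A q f" "smooth_near A q h"
    using assms smooth_nearI smooth_fun_cong by blast+
  moreover have "\<forall>\<^sub>F p in nhds q. f p = h p"
    using assms eventually_nhds by blast
  ultimately show ?thesis using assms(1) unfolding tangent_space_def by blast
qed

lemma tangent_add:
  "v \<in> tangent_space A q \<Longrightarrow> smooth_near A q f \<Longrightarrow> smooth_near A q h \<Longrightarrow>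
    v (\<lambda>p. f p + h p) = v f + v h"
  using tangent_lin[of v q f h 1 1] by simp

lemma tangent_const:
  assumes "v \<in> tangent_space A q"
  shows "v (\<lambda>p. k) = 0"
proof -
  \<comment> \<open>Since 1 = 1 * 1, the product rule gives v(1) = 2 v(1).\<close>
  have "v (\<lambda>p. 1) = 0"
    using tangent_mult[OF assms smooth_near_const[of q 1] smooth_near_const[of q 1]] by simp
  then show ?thesis
    using tangent_lin[OF assms smooth_near_const[of q 1] smooth_near_const[of q 1], of k 0] by simp
qed

lemma tangent_sum:
  "v \<in> tangent_space A q \<Longrightarrow> (\<And>i. i \<in> I \<Longrightarrow> smooth_near A q (f i)) \<Longrightarrow>
    v (\<lambda>p. \<Sum>i\<in>I. f i p) = (\<Sum>i\<in>I. v (f i))"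
proof (induction I rule: infinite_finite_induct)
  case (insert i I)
  have "v (\<lambda>p. f i p + (\<Sum>i\<in>I. f i p)) = v (f i) + v (\<lambda>p. \<Sum>i\<in>I. f i p)"
    using insert.prems by (intro tangent_add smooth_near_sum) auto
  then show ?case using insert by simp
qed (simp_all add: tangent_const)

lemma tangent_zero: "(\<lambda>f. 0) \<in> tangent_space A q"
  by (simp add: tangent_space_def)

lemma tangent_lincomb:
  assumes u: "u \<in> tangent_space A q" and v: "v \<in> tangent_space A q"
  shows "lincomb a u b v \<in> tangent_space A q"
proof -
  have "lincomb a u b v f = lincomb a u b v h"
    if "smooth_near A q f" "smooth_near A q h" "\<forall>\<^sub>F p in nhds q. f p = h p" for f h
  proof -
    have "u f = u h" "v f = v h" using u v that unfolding tangent_space_def by blast+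
    then show ?thesis by (simp add: lincomb_def)
  qed
  moreover have "lincomb a u b v (\<lambda>p. s * f p + t * h p) = s * lincomb a u b v f + t * lincomb a u b v h"
    if "smooth_near A q f" "smooth_near A q h" for f h s t
    using tangent_lin[OF u that] tangent_lin[OF v that] by (simp add: lincomb_def algebra_simps)
  moreover have "lincomb a u b v (\<lambda>p. f p * h p) = lincomb a u b v f * h q + f q * lincomb a u b v h"
    if "smooth_near A q f" "smooth_near A q h" for f h
    using tangent_mult[OF u that] tangent_mult[OF v that] by (simp add: lincomb_def algebra_simps)
  moreover have "lincomb a u b v f = 0" if "\<not> smooth_near A q f" for f
    using u v that by (simp add: lincomb_def tangent_nonsmooth)
  ultimately show ?thesis unfolding tangent_space_def by blast
qed

lemma tangent_lincomb_sum:
  "(\<And>i. i \<in> I \<Longrightarrow> u i \<in> tangent_space A q) \<Longrightarrow> (\<lambda>f. \<Sum>i\<in>I. a i * u i f) \<in> tangent_space A q"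
proof (induction I rule: infinite_finite_induct)
  case (insert i I)
  have "lincomb (a i) (u i) 1 (\<lambda>f. \<Sum>i\<in>I. a i * u i f) \<in> tangent_space A q"
    using insert by (intro tangent_lincomb) auto
  then show ?case using insert by (simp add: lincomb_def)
qed (simp_all add: tangent_zero)

lemma vfieldsI:
  assumes "\<And>q. q \<in> U \<Longrightarrow> X q \<in> tangent_space A q"
    and "\<And>W f. open W \<Longrightarrow> W \<subseteq> U \<Longrightarrow> smooth_fun A W f \<Longrightarrow> smooth_fun A W (\<lambda>q. X q f)"
  shows "X \<in> vfields A U"
  unfolding vfields_def mem_Collect_eq
proof (intro conjI ballI allI impI)
  show "X q \<in> tangent_space A q" if "q \<in> U" for q by (rule assms(1)[OF that])
  show "smooth_fun A W (\<lambda>q. X q f)" if "open W \<and> W \<subseteq> U \<and> smooth_fun A W f" for W f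
    using that by (elim conjE) (rule assms(2))
qed

lemma vfieldsD: "X \<in> vfields A U \<Longrightarrow> q \<in> U \<Longrightarrow> X q \<in> tangent_space A q"
  unfolding vfields_def mem_Collect_eq by (elim conjE bspec)

lemma vfields_smooth:
  "X \<in> vfields A U \<Longrightarrow> open W \<Longrightarrow> W \<subseteq> U \<Longrightarrow> smooth_fun A W f \<Longrightarrow> smooth_fun A W (\<lambda>q. X q f)"
  unfolding vfields_def mem_Collect_eq by (elim conjE, drule spec, drule spec, erule mp, intro conjI)

lemma vfields_subset:
  assumes "X \<in> vfields A U" "V \<subseteq> U"
  shows "X \<in> vfields A V"
  by (rule vfieldsI)
    (use assms vfieldsD in blast, rule vfields_smooth[OF assms(1)], use assms(2) in auto)

lemma vfields_zero: "(\<lambda>q f. 0) \<in> vfields A U"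
  by (rule vfieldsI) (rule tangent_zero, rule smooth_fun_const)

lemma vfields_lincomb:
  assumes X: "X \<in> vfields A U" and Y: "Y \<in> vfields A U"
    and f: "smooth_fun A U f" and h: "smooth_fun A U h"
  shows "(\<lambda>q. lincomb (f q) (X q) (h q) (Y q)) \<in> vfields A U"
proof -
  have "smooth_fun A W (\<lambda>q. lincomb (f q) (X q) (h q) (Y q) k)"
    if W: "open W" "W \<subseteq> U" and k: "smooth_fun A W k" for W k
    unfolding lincomb_def
    by (intro smooth_fun_add smooth_fun_mult W smooth_fun_subset[OF f] smooth_fun_subset[OF h]
        vfields_smooth[OF X W k] vfields_smooth[OF Y W k])
  then show ?thesis
    by (intro vfieldsI tangent_lincomb vfieldsD[OF X] vfieldsD[OF Y])
qed

lemma vfields_lincomb_sum: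
  assumes "open U"
  shows "(\<And>i. i \<in> I \<Longrightarrow> X i \<in> vfields A U \<and> smooth_fun A U (f i)) \<Longrightarrow>
    (\<lambda>q k. \<Sum>i\<in>I. f i q * X i q k) \<in> vfields A U"
proof (induction I rule: infinite_finite_induct)
  case (insert i I)
  have "(\<lambda>q. lincomb (f i q) (X i q) 1 (\<lambda>k. \<Sum>i\<in>I. f i q * X i q k)) \<in> vfields A U"
    using insert assms by (intro vfields_lincomb smooth_fun_const) auto
  then show ?case using insert by (simp add: lincomb_def)
qed (simp_all add: vfields_zero)

section \<open>Coordinate fields span the tangent spaces\<close>

text \<open>The i-th partial derivative in the chart. The value 0 on non-smooth functions matches
  the normalisation in \<open>tangent_space\<close>.\<close>

definition coord_field :: "'a set \<Rightarrow> ('a \<Rightarrow> real ^ 'n) \<Rightarrow> 'n \<Rightarrow> 'a vfield" where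
  "coord_field U c i = (\<lambda>q f. if smooth_near A q f
     then frechet_derivative (f \<circ> inv_into U c) (at (c q)) (axis i 1) else 0)"

lemma chart_rep_derivative:
  assumes U: "(U, c) \<in> A" "q \<in> U" and f: "smooth_near A q f"
  shows "(f \<circ> inv_into U c has_derivative frechet_derivative (f \<circ> inv_into U c) (at (c q))) (at (c q))"
proof -
  obtain W where W: "open W" "q \<in> W" "smooth_fun A W f" using f by (auto simp: smooth_near_def)
  show ?thesis
    by (rule Ck_on_SucD(1)[OF smooth_funD[OF W(3) U(1)]]) (use W(2) U(2) in auto)
qed

lemma coord_field_eqI:
  assumes "(U, c) \<in> A" "q \<in> U" "smooth_near A q f"
    "(f \<circ> inv_into U c has_derivative f') (at (c q))"
  shows "coord_field U c i q f = f' (axis i 1)"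
  using assms frechet_derivative_at[OF assms(4)] by (simp add: coord_field_def)

lemma coord_field_tangent:
  assumes U: "(U, c) \<in> A" "q \<in> U"
  shows "coord_field U c i q \<in> tangent_space A q"
proof -
  let ?r = "\<lambda>f. f \<circ> inv_into U c"
  let ?D = "\<lambda>f. frechet_derivative (?r f) (at (c q))"
  let ?v = "coord_field U c i q"
  have v: "?v f = ?D f (axis i 1)" if "smooth_near A q f" for f
    using that by (simp add: coord_field_def)
  note d = chart_rep_derivative[OF U]
  have q: "inv_into U c (c q) = q" by (rule chart_inverse(1)[OF U])
  have cong: "?v f = ?v h"
    if f: "smooth_near A q f" and h: "smooth_near A q h" and ev: "\<forall>\<^sub>F p in nhds q. f p = h p" for f h
  proof -
    obtain W where W: "open W" "q \<in> W" "\<And>p. p \<in> W \<Longrightarrow> f p = h p"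
      using ev unfolding eventually_nhds by blast
    have "(?r h has_derivative ?D f) (at (c q))"
      by (rule has_derivative_transform_within_open[OF d[OF f] chart_image_open[OF U(1) W(1)]])
        (use W chart_inverse(3)[OF U(1)] U(2) in auto)
    from coord_field_eqI[OF U h this] show ?thesis unfolding v[OF f] by (rule sym)
  qed
  have lin: "?v (\<lambda>p. a * f p + b * h p) = a * ?v f + b * ?v h"
    if f: "smooth_near A q f" and h: "smooth_near A q h" for f h a b
  proof -
    have "((\<lambda>p. a * f p + b * h p) \<circ> inv_into U c has_derivative (\<lambda>w. a * ?D f w + b * ?D h w)) (at (c q))"
      using has_derivative_add[OF has_derivative_mult_right[OF d[OF f], of a]
          has_derivative_mult_right[OF d[OF h], of b]] unfolding comp_def .
    moreover have "smooth_near A q (\<lambda>p. a * f p + b * h p)"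
      by (intro smooth_near_add smooth_near_mult smooth_near_const f h)
    ultimately show ?thesis unfolding v[OF f] v[OF h] by (intro coord_field_eqI[OF U])
  qed
  have mult: "?v (\<lambda>p. f p * h p) = ?v f * h q + f q * ?v h"
    if f: "smooth_near A q f" and h: "smooth_near A q h" for f h
  proof -
    have "((\<lambda>p. f p * h p) \<circ> inv_into U c has_derivative (\<lambda>w. f q * ?D h w + ?D f w * h q)) (at (c q))"
      using has_derivative_mult[OF d[OF f] d[OF h]] unfolding comp_def q .
    from coord_field_eqI[OF U smooth_near_mult[OF f h] this] show ?thesis
      unfolding v[OF f] v[OF h] by (simp only: add.commute)
  qed
  have non: "?v f = 0" if "\<not> smooth_near A q f" for f
    using that by (simp add: coord_field_def)
  show ?thesis
    unfolding tangent_space_def mem_Collect_eq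
    by (intro conjI allI impI; (elim conjE)?; (rule non cong lin mult; assumption))
qed

lemma coord_field_vfield:
  assumes U: "(U, c) \<in> A"
  shows "coord_field U c i \<in> vfields A U"
proof -
  have "smooth_fun A W (\<lambda>q. coord_field U c i q f)"
    if W: "open W" "W \<subseteq> U" and f: "smooth_fun A W f" for W f
  proof (rule smooth_fun_cong[OF W(1)])
    let ?F = "\<lambda>y. frechet_derivative (f \<circ> inv_into U c) (at y) (axis i 1)"
    have "U \<inter> W = W" using W by blast
    moreover have "smooth_on (c ` (U \<inter> W)) (f \<circ> inv_into U c)"
      using f U unfolding smooth_fun_def by blast
    ultimately have "smooth_on (c ` W) ?F" using smooth_on_deriv by metis
    then show "smooth_fun A W (?F \<circ> c)" by (rule smooth_fun_chart_compose[OF U W])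
    show "(?F \<circ> c) q = coord_field U c i q f" if "q \<in> W" for q
      using smooth_nearI[OF W(1) that f] by (simp add: coord_field_def)
  qed
  then show ?thesis by (intro vfieldsI coord_field_tangent[OF U])
qed

lemma coord_field_coordinate:
  assumes U: "(U, c) \<in> A" and q: "q \<in> U"
  shows "coord_field U c i q (\<lambda>p. c p $ k) = (if i = k then 1 else 0)"
proof -
  have "((\<lambda>p. c p $ k) \<circ> inv_into U c has_derivative (\<lambda>w. w $ k)) (at (c q))"
  proof (rule has_derivative_transform_within_open[where f = "\<lambda>y. y $ k"])
    show "open (c ` (U \<inter> U))" by (rule chart_image_open[OF U chart_open[OF U]])
    show "((\<lambda>y. y $ k) has_derivative (\<lambda>w. w $ k)) (at (c q))"
      by (rule bounded_linear_imp_has_derivative[OF bounded_linear_vec_nth])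
  qed (use q chart_inverse(2)[OF U] in auto)
  moreover have "smooth_near A q (\<lambda>p. c p $ k)"
    by (rule smooth_nearI[OF chart_open[OF U] q smooth_fun_coordinate[OF U]])
  ultimately have "coord_field U c i q (\<lambda>p. c p $ k) = axis i 1 $ k"
    using coord_field_eqI[OF U q] by blast
  then show ?thesis by (simp add: axis_def)
qed

text \<open>Apply v to the Hadamard expansion of f around q. The constant is annihilated, and in
  each product (x_i - x_i(q)) h_i the first factor vanishes at q, so only v(x_i) h_i(q) survives,
  where h_i(q) is the i-th partial derivative of f.\<close>

lemma tangent_expand:
  assumes U: "(U, c) \<in> A" and q: "q \<in> U" and v: "v \<in> tangent_space A q"
  shows "v = (\<lambda>f. \<Sum>i\<in>UNIV. v (\<lambda>p. c p $ i) * coord_field U c i q f)"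
proof
  fix f
  show "v f = (\<Sum>i\<in>UNIV. v (\<lambda>p. c p $ i) * coord_field U c i q f)"
  proof (cases "smooth_near A q f")
    case False
    then show ?thesis using tangent_nonsmooth[OF v] by (simp add: coord_field_def)
  next
    case True
    let ?\<phi> = "f \<circ> inv_into U c" and ?a = "c q"
    obtain W where W: "open W" "q \<in> W" "smooth_fun A W f" using True by (auto simp: smooth_near_def)
    have "?a \<in> c ` (U \<inter> W)" using q W by blast
    then obtain r where r: "r > 0" "ball ?a r \<subseteq> c ` (U \<inter> W)"
      using chart_image_open[OF U W(1)] open_contains_ball by blast
    have "smooth_on (ball ?a r) ?\<phi>"
      using W(3) U r(2) smooth_on_subset unfolding smooth_fun_def by blast
    from smooth_on_Hadamard[OF this r(1)] obtain h where
      h: "\<And>b. smooth_on (ball ?a r) (h b)"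
      and \<phi>: "\<And>x. x \<in> ball ?a r \<Longrightarrow> ?\<phi> x = ?\<phi> ?a + (\<Sum>b\<in>Basis. ((x - ?a) \<bullet> b) * h b x)"
      and ha: "\<And>b. h b ?a = frechet_derivative ?\<phi> (at ?a) b"
      by blast
    \<comment> \<open>The expansion holds over a coordinate ball; B is its preimage in the manifold,
      on which the factors \<open>h b \<circ> c\<close> are smooth.\<close>
    define B where "B = U \<inter> c -` ball ?a r"
    have B: "open B" "B \<subseteq> U" "q \<in> B"
      using continuous_open_preimage[OF chart_continuous[OF U] chart_open[OF U] open_ball] q r(1)
      by (auto simp: B_def)
    have smh: "smooth_near A q (h b \<circ> c)" for b
      by (rule smooth_nearI[OF B(1,3) smooth_fun_chart_compose[OF U B(1,2)]])
        (rule smooth_on_subset[OF h], auto simp: B_def)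
    have smx: "smooth_near A q (\<lambda>p. c p $ i)" for i
      by (rule smooth_nearI[OF chart_open[OF U] q smooth_fun_coordinate[OF U]])
    have smd: "smooth_near A q (\<lambda>p. c p $ i + - ?a $ i)" for i
      by (intro smooth_near_add smx smooth_near_const)
    let ?t = "\<lambda>i p. (c p $ i + - ?a $ i) * (h (axis i 1) \<circ> c) p"
    have smt: "smooth_near A q (?t i)" for i by (intro smooth_near_mult smd smh)
    have eq: "f p = f q + (\<Sum>i\<in>UNIV. ?t i p)" if "p \<in> B" for p
      using \<phi>[of "c p"] that q chart_inverse(1)[OF U]
      by (simp add: B_def sum_Basis_axis inner_axis)
    have BW: "open (B \<inter> W)" "q \<in> B \<inter> W" using B W by auto
    have "v f = v (\<lambda>p. f q + (\<Sum>i\<in>UNIV. ?t i p))"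
      by (rule tangent_cong_open[OF v BW smooth_fun_subset[OF W(3)]]) (use eq in auto)
    also have "\<dots> = v (\<lambda>p. f q) + v (\<lambda>p. \<Sum>i\<in>UNIV. ?t i p)"
      by (rule tangent_add[OF v smooth_near_const smooth_near_sum[OF smt]])
    also have "\<dots> = (\<Sum>i\<in>UNIV. v (?t i))"
      unfolding tangent_const[OF v] by (subst tangent_sum[OF v smt]) (rule add_0)
    also have "\<dots> = (\<Sum>i\<in>UNIV. v (\<lambda>p. c p $ i) * coord_field U c i q f)"
    proof (rule sum.cong[OF refl])
      fix i
      have "v (?t i) = v (\<lambda>p. c p $ i + - ?a $ i) * (h (axis i 1) \<circ> c) q
          + (c q $ i + - ?a $ i) * v (h (axis i 1) \<circ> c)"
        by (rule tangent_mult[OF v smd smh])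
      also have "v (\<lambda>p. c p $ i + - ?a $ i) = v (\<lambda>p. c p $ i)"
        using tangent_add[OF v smx[of i] smooth_near_const[of q "- ?a $ i"]] unfolding tangent_const[OF v]
        by (simp only: add_0_right)
      finally show "v (?t i) = v (\<lambda>p. c p $ i) * coord_field U c i q f"
        using True by (simp add: ha coord_field_def)
    qed
    finally show ?thesis .
  qed
qed

end


section \<open>Orthonormal frames and volume forms\<close>

locale riemannian_manifold = atlas_manifold A
  for A :: "('a::{t2_space,second_countable_topology}, 'n::finite) atlas" +
  fixes g :: "'a metric_field"
  assumes metric: "riemannian_metric A g"
begin

lemma metric_sym: "u \<in> tangent_space A q \<Longrightarrow> v \<in> tangent_space A q \<Longrightarrow> g q u v = g q v u"
  using metric unfolding riemannian_metric_def by (elim conjE) simp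

lemma metric_lincomb:
  "u \<in> tangent_space A q \<Longrightarrow> v \<in> tangent_space A q \<Longrightarrow> w \<in> tangent_space A q \<Longrightarrow>
    g q (lincomb a u b v) w = a * g q u w + b * g q v w"
  using metric unfolding riemannian_metric_def by (elim conjE) simp

lemma metric_pos: "u \<in> tangent_space A q \<Longrightarrow> u \<noteq> (\<lambda>f. 0) \<Longrightarrow> g q u u > 0"
  using metric unfolding riemannian_metric_def by (elim conjE) simp

lemma metric_smooth:
  "open U \<Longrightarrow> X \<in> vfields A U \<Longrightarrow> Y \<in> vfields A U \<Longrightarrow> smooth_fun A U (\<lambda>q. g q (X q) (Y q))"
  using metric unfolding riemannian_metric_def by (elim conjE) simp

lemma metric_zero: "w \<in> tangent_space A q \<Longrightarrow> g q (\<lambda>f. 0) w = 0"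
  using metric_lincomb[OF tangent_zero tangent_zero, of w q 0 0] by (simp add: lincomb_def)

lemma metric_lincomb_sum:
  assumes w: "w \<in> tangent_space A q"
  shows "(\<And>i. i \<in> I \<Longrightarrow> u i \<in> tangent_space A q) \<Longrightarrow>
    g q (\<lambda>f. \<Sum>i\<in>I. a i * u i f) w = (\<Sum>i\<in>I. a i * g q (u i) w)"
proof (induction I rule: infinite_finite_induct)
  case (insert i I)
  have "g q (lincomb (a i) (u i) 1 (\<lambda>f. \<Sum>i\<in>I. a i * u i f)) w
      = a i * g q (u i) w + 1 * g q (\<lambda>f. \<Sum>i\<in>I. a i * u i f) w"
    using insert.prems by (intro metric_lincomb w tangent_lincomb_sum) auto
  then show ?case using insert by (simp add: lincomb_def)
qed (simp_all add: metric_zero w)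

text \<open>
  Gram-Schmidt on the coordinate fields. That the constructed fields annihilate the coordinates
  not yet processed guarantees that the next coordinate field is not in their span.
\<close>

lemma orthonormal_frame:
  assumes U: "(U, c) \<in> A"
  obtains e :: "'n \<Rightarrow> 'a vfield" where "\<And>i. e i \<in> vfields A U"
    and "\<And>q i j. q \<in> U \<Longrightarrow> g q (e i q) (e j q) = (if i = j then 1 else 0)"
proof -
  have oU: "open U" by (rule chart_open[OF U])
  have "\<exists>e. (\<forall>i\<in>I. e i \<in> vfields A U) \<and>
      (\<forall>q\<in>U. \<forall>i\<in>I. \<forall>j\<in>I. g q (e i q) (e j q) = (if i = j then 1 else 0)) \<and>
      (\<forall>q\<in>U. \<forall>i\<in>I. \<forall>k. k \<notin> I \<longrightarrow> e i q (\<lambda>p. c p $ k) = 0)" for I :: "'n set"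
    using finite[of I]
  proof (induction I rule: finite_induct)
    case (insert k I)
    then obtain e where vf: "\<And>i. i \<in> I \<Longrightarrow> e i \<in> vfields A U"
      and on: "\<And>q i j. q \<in> U \<Longrightarrow> i \<in> I \<Longrightarrow> j \<in> I \<Longrightarrow> g q (e i q) (e j q) = (if i = j then 1 else 0)"
      and co: "\<And>q i m. q \<in> U \<Longrightarrow> i \<in> I \<Longrightarrow> m \<notin> I \<Longrightarrow> e i q (\<lambda>p. c p $ m) = 0"
      by blast
    let ?d = "coord_field U c k"
    let ?x = "\<lambda>m p. c p $ m"
    \<comment> \<open>P is the orthogonal projection of the new coordinate field onto the span of
      the frame so far, u the remainder and s the reciprocal length of u. The coefficient 0 in b
      turns \<open>lincomb\<close> into multiplication by s.\<close>
    define P where "P q f = (\<Sum>i\<in>I. g q (?d q) (e i q) * e i q f)" for q f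
    define u where "u q = lincomb 1 (?d q) (-1) (P q)" for q
    define s where "s q = g q (u q) (u q) powr (-1/2)" for q
    define b where "b q = lincomb (s q) (u q) 0 (u q)" for q
    note d = coord_field_vfield[OF U]
    have P: "P \<in> vfields A U"
      unfolding P_def[abs_def] by (rule vfields_lincomb_sum[OF oU]) (use vf d metric_smooth[OF oU] in blast)
    have u: "u \<in> vfields A U"
      unfolding u_def[abs_def] by (intro vfields_lincomb d P smooth_fun_const oU)
    \<comment> \<open>On coordinates outside I the projection vanishes. The case m = k shows that u
      is nonzero; the cases outside \<open>insert k I\<close> renew the invariant.\<close>
    have u_x: "u q (?x m) = (if m = k then 1 else 0)" if "q \<in> U" "m \<notin> I" for q m
      using that co by (auto simp: u_def lincomb_def P_def coord_field_coordinate[OF U])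
    have u_pos: "g q (u q) (u q) > 0" if q: "q \<in> U" for q
    proof (rule metric_pos[OF vfieldsD[OF u q]])
      show "u q \<noteq> (\<lambda>f. 0)" using u_x[OF q insert.hyps(2)] by auto
    qed
    have u_e: "g q (u q) (e j q) = 0" if q: "q \<in> U" and j: "j \<in> I" for q j
    proof -
      have "g q (P q) (e j q) = (\<Sum>i\<in>I. g q (?d q) (e i q) * g q (e i q) (e j q))"
        unfolding P_def[abs_def] by (rule metric_lincomb_sum) (use vfieldsD[OF vf q] j in auto)
      also have "\<dots> = (\<Sum>i\<in>I. if i = j then g q (?d q) (e i q) else 0)"
        by (rule sum.cong[OF refl]) (use on[OF q _ j] in auto)
      also have "\<dots> = g q (?d q) (e j q)" using insert.hyps j by simp
      finally show ?thesis
        unfolding u_def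
        by (subst metric_lincomb[OF vfieldsD[OF d q] vfieldsD[OF P q] vfieldsD[OF vf[OF j] q]]) simp
    qed
    have sm_s: "smooth_fun A U s"
      unfolding s_def[abs_def] by (rule smooth_fun_powr[OF oU metric_smooth[OF oU u u] u_pos])
    have b: "b \<in> vfields A U"
      unfolding b_def[abs_def] by (intro vfields_lincomb u sm_s smooth_fun_const oU)
    have b_left: "g q (b q) w = s q * g q (u q) w" if "q \<in> U" "w \<in> tangent_space A q" for q w
      unfolding b_def using vfieldsD[OF u that(1)] that(2) by (subst metric_lincomb) auto
    have b_b: "g q (b q) (b q) = 1" if q: "q \<in> U" for q
    proof -
      have "g q (b q) (b q) = s q * (s q * g q (u q) (u q))"
        using b_left[OF q] metric_sym vfieldsD[OF u q] vfieldsD[OF b q] by metis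
      also have "s q * s q = g q (u q) (u q) powr (-1)"
        unfolding s_def powr_add[symmetric] by simp
      then have "s q * (s q * g q (u q) (u q)) = 1"
        using u_pos[OF q] by (simp add: powr_minus field_simps flip: mult.assoc)
      finally show ?thesis .
    qed
    have b_e: "g q (b q) (e j q) = 0" "g q (e j q) (b q) = 0" if q: "q \<in> U" and j: "j \<in> I" for q j
    proof -
      show "g q (b q) (e j q) = 0" using b_left[OF q vfieldsD[OF vf[OF j] q]] u_e[OF q j] by simp
      then show "g q (e j q) (b q) = 0"
        using metric_sym[OF vfieldsD[OF b q] vfieldsD[OF vf[OF j] q]] by simp
    qed
    show ?case
    proof (intro exI[of _ "e(k := b)"] conjI ballI allI impI)
      show "(e(k := b)) i \<in> vfields A U" if "i \<in> insert k I" for i using that vf b by auto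
      show "g q ((e(k := b)) i q) ((e(k := b)) j q) = (if i = j then 1 else 0)"
        if "q \<in> U" "i \<in> insert k I" "j \<in> insert k I" for q i j
        using that on b_b b_e insert.hyps(2) by auto
      show "(e(k := b)) i q (?x m) = 0" if "q \<in> U" "i \<in> insert k I" "m \<notin> insert k I" for q i m
        using that co u_x by (auto simp: b_def lincomb_def)
    qed
  qed simp
  from this[of UNIV] obtain e :: "'n \<Rightarrow> 'a vfield" where "\<forall>i. e i \<in> vfields A U"
    "\<forall>q\<in>U. \<forall>i j. g q (e i q) (e j q) = (if i = j then 1 else 0)" by auto
  then show ?thesis by (intro that[of e]) auto
qed

section \<open>The local volume form of an orthonormal frame\<close>

text \<open>The wedge product of the one-forms g(-, e_j); for an orthonormal frame these are the
  dual coframe.\<close>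

definition frame_form :: "('n \<Rightarrow> 'a vfield) \<Rightarrow> ('a, 'n) topform" where
  "frame_form e q E = det (\<chi> i j. g q (E i) (e j q))"

lemma frame_form_top_form:
  assumes "open U" "\<And>i. e i \<in> vfields A U"
  shows "top_form_on A U (frame_form e)"
  unfolding top_form_on_def
proof (intro conjI ballI allI impI)
  fix q and E :: "'n \<Rightarrow> 'a tvec" and i u w a b
  assume q: "q \<in> U" and u: "u \<in> tangent_space A q" "w \<in> tangent_space A q"
  note e = vfieldsD[OF assms(2) q]
  \<comment> \<open>Only row i depends on z; this shape lets linearity of the determinant in a row
    apply.\<close>
  have upd: "(\<chi> k j. g q ((E(i := z)) k) (e j q)) = (\<chi> k. if k = i then (\<chi> j. g q z (e j q)) else (\<chi> j. g q (E k) (e j q)))"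
    for z by (auto simp: vec_eq_iff)
  have "(\<chi> j. g q (lincomb a u b w) (e j q)) = a *s (\<chi> j. g q u (e j q)) + b *s (\<chi> j. g q w (e j q))"
    using metric_lincomb[OF u e] by (simp add: vec_eq_iff)
  then show "frame_form e q (E(i := lincomb a u b w))
      = a * frame_form e q (E(i := u)) + b * frame_form e q (E(i := w))"
    unfolding frame_form_def upd by (simp only: det_row_add det_row_mul)
next
  fix q and E :: "'n \<Rightarrow> 'a tvec" and i j
  assume "i \<noteq> j \<and> E i = E j"
  then show "frame_form e q E = 0"
    unfolding frame_form_def by (intro det_identical_rows[of i j]) (auto simp: row_def)
next
  fix V and Y :: "'n \<Rightarrow> 'a vfield"
  assume V: "open V \<and> V \<subseteq> U \<and> (\<forall>i. Y i \<in> vfields A V)"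
  show "smooth_fun A V (\<lambda>q. frame_form e q (\<lambda>i. Y i q))"
    \<comment> \<open>The permutation expansion is a polynomial in the smooth functions g(Y_i,
      e_j).\<close>
    unfolding frame_form_def det_def
    by (intro smooth_fun_sum smooth_fun_mult smooth_fun_const smooth_fun_prod)
      (use V in \<open>auto intro!: metric_smooth vfields_subset[OF assms(2)]\<close>)
qed

text \<open>Expand both arguments of g by \<open>tangent_expand\<close>. Linearity is available in
  the first slot, so the second is reached by symmetry. Allowing two different tuples covers the
  mixed matrix that defines \<open>frame_form\<close> as well as the Gram matrix of a single
  tuple.\<close>

lemma gram_matrix_coordinates:
  assumes U: "(U, c) \<in> A" "q \<in> U"
    and E: "\<And>i. E i \<in> tangent_space A q" and F: "\<And>i. F i \<in> tangent_space A q"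
  shows "(\<chi> i j. g q (E i) (F j)) = (\<chi> i k. E i (\<lambda>p. c p $ k)) **
      (\<chi> i j. g q (coord_field U c i q) (coord_field U c j q)) ** transpose (\<chi> i k. F i (\<lambda>p. c p $ k))"
proof -
  let ?d = "\<lambda>i. coord_field U c i q"
  note d = coord_field_tangent[OF U]
  have left: "g q u w = (\<Sum>k\<in>UNIV. u (\<lambda>p. c p $ k) * g q (?d k) w)"
    if "u \<in> tangent_space A q" "w \<in> tangent_space A q" for u w
    by (subst tangent_expand[OF U that(1)], rule metric_lincomb_sum[OF that(2) d])
  have "g q (E i) (F j) = (\<Sum>l\<in>UNIV. (\<Sum>k\<in>UNIV. E i (\<lambda>p. c p $ k) * g q (?d k) (?d l)) * F j (\<lambda>p. c p $ l))"
    for i j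
  proof -
    have "g q (E i) (F j) = g q (F j) (E i)" by (rule metric_sym[OF E F])
    also have "\<dots> = (\<Sum>l\<in>UNIV. F j (\<lambda>p. c p $ l) * g q (?d l) (E i))" by (rule left[OF F E])
    also have "\<dots> = (\<Sum>l\<in>UNIV. F j (\<lambda>p. c p $ l) * g q (E i) (?d l))"
      by (rule sum.cong[OF refl]) (subst metric_sym[OF d E], rule refl)
    also have "\<dots> = (\<Sum>l\<in>UNIV. F j (\<lambda>p. c p $ l) * (\<Sum>k\<in>UNIV. E i (\<lambda>p. c p $ k) * g q (?d k) (?d l)))"
      by (rule sum.cong[OF refl]) (subst left[OF E d], rule refl)
    finally show ?thesis by (simp only: mult.commute)
  qed
  then show ?thesis
    by (simp add: vec_eq_iff matrix_matrix_mult_def transpose_def)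
qed

text \<open>Both the arbitrary orthonormal tuple E and the frame e have the identity as Gram matrix;
  factoring through coordinates relates the mixed determinant to these two.\<close>

lemma frame_form_volume_form:
  assumes U: "(U, c) \<in> A" and e: "\<And>i. e i \<in> vfields A U"
    and on: "\<And>q i j. q \<in> U \<Longrightarrow> g q (e i q) (e j q) = (if i = j then 1 else 0)"
  shows "volume_form_on A g U (frame_form e)"
  unfolding volume_form_on_def
proof (intro conjI ballI allI impI; (elim conjE)?)
  show "top_form_on A U (frame_form e)" by (rule frame_form_top_form[OF chart_open[OF U] e])
next
  fix q and E :: "'n \<Rightarrow> 'a tvec"
  assume q: "q \<in> U" and E: "\<forall>i. E i \<in> tangent_space A q"
    and onE: "\<forall>i j. g q (E i) (E j) = (if i = j then 1 else 0)"
  let ?G = "\<chi> i j. g q (coord_field U c i q) (coord_field U c j q)"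
  let ?M = "\<lambda>F. \<chi> i k. F i (\<lambda>p. c p $ k)"
  let ?e = "\<lambda>i. e i q"
  note prod = gram_matrix_coordinates[OF U q]
  have unit: "det (?M F) * det ?G * det (?M F) = 1"
    if "\<And>i. F i \<in> tangent_space A q" "\<And>i j. g q (F i) (F j) = (if i = j then 1 else 0)" for F
  proof -
    have "(\<chi> i j. g q (F i) (F j)) = mat 1" using that(2) by (simp add: mat_def)
    then show ?thesis
      using arg_cong[OF prod[of F F, OF that(1) that(1)], of det] by (simp add: det_mul)
  qed
  have "frame_form e q E = det (?M E) * det ?G * det (?M ?e)"
    unfolding frame_form_def using E by (subst prod) (simp_all add: vfieldsD[OF e q] det_mul)
  moreover have "det (?M E) * det ?G * det (?M E) = 1" using E onE by (intro unit) auto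
  moreover have "det (?M ?e) * det ?G * det (?M ?e) = 1"
    using on[OF q] by (intro unit vfieldsD[OF e q])
  \<comment> \<open>With x = det M_E, y = det M_e and d = det G, the form is x d y, and its square
    is (x d x)(y d y) = 1.\<close>
  ultimately have "frame_form e q E ^ 2 = 1"
    by (simp add: power2_eq_square) algebra
  then show "\<bar>frame_form e q E\<bar> = 1" by (simp add: power2_eq_1_iff abs_eq_iff')
qed

section \<open>Vanishing of the first Koszul form\<close>

lemma first_koszul_form_levi_civita:
  assumes lc: "levi_civita A g N" and koszul: "first_koszul_form A D g \<alpha>"
    and same: "same_connection A D N"
    and V: "open V" and X: "X \<in> vfields A V" and p: "p \<in> V"
  shows "\<alpha> p (X p) = 0"
proof -
  obtain U c where U: "(U, c) \<in> A" "p \<in> U" by (rule chart_around)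
  obtain e :: "'n \<Rightarrow> 'a vfield" where e: "\<And>i. e i \<in> vfields A U"
    and on: "\<And>q i j. q \<in> U \<Longrightarrow> g q (e i q) (e j q) = (if i = j then 1 else 0)"
    using orthonormal_frame[OF U(1)] by blast
  define W where "W = U \<inter> V"
  have oU: "open U" by (rule chart_open[OF U(1)])
  have W: "open W" "W \<subseteq> U" "W \<subseteq> V" "p \<in> W" using oU V U(2) p by (auto simp: W_def)
  have XW: "X \<in> vfields A W" by (rule vfields_subset[OF X W(3)])
  have eW: "e i \<in> vfields A W" for i by (rule vfields_subset[OF e W(2)])
  note Xp = vfieldsD[OF XW W(4)]
  have N_conn: "connection A N" using lc by (simp add: levi_civita_def)
  have N_e: "N X (e i) \<in> vfields A W" for i
    using N_conn[unfolded connection_def, rule_format, OF W(1), THEN conjunct1] XW eW by blast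
  have compat: "X p (\<lambda>q. g q (e i q) (e i q)) = g p (N X (e i) p) (e i p) + g p (e i p) (N X (e i) p)"
    for i
    using lc[unfolded levi_civita_def, THEN conjunct2, THEN conjunct2, rule_format, OF W(1) XW eW eW W(4)] .
  \<comment> \<open>The functions g(e_i, e_i) and v(e) are known to equal 1 only on W, so locality
    of tangent vectors is used before constants are annihilated.\<close>
  have one: "X p k = 0" if "\<And>q. q \<in> W \<Longrightarrow> k q = 1" for k
  proof -
    have "X p (\<lambda>q. 1) = X p k"
      by (rule tangent_cong_open[OF Xp W(1,4) smooth_fun_const[OF W(1)]]) (use that in simp)
    then show ?thesis using tangent_const[OF Xp] by simp
  qed
  have skew: "g p (N X (e i) p) (e i p) = 0" for i
  proof -
    have "X p (\<lambda>q. g q (e i q) (e i q)) = 0" by (rule one) (use on W(2) in auto)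
    then show ?thesis
      using compat[of i] metric_sym[OF vfieldsD[OF N_e W(4)] vfieldsD[OF eW W(4)], of i i] by simp
  qed
  have frame1: "frame_form e q (\<lambda>i. e i q) = 1" if "q \<in> W" for q
  proof -
    have "(\<chi> i j. g q (e i q) (e j q)) = mat 1" using on that W(2) by (auto simp: mat_def)
    then show ?thesis by (simp add: frame_form_def)
  qed
  \<comment> \<open>The matrix is the identity with row i replaced by the components of w in the
    frame. Cramer's rule for rows picks out the i-th component, so each term of the covariant
    derivative is a diagonal entry g(nabla_X e_i, e_i).\<close>
  have sub: "frame_form e p ((\<lambda>j. e j p)(i := w)) = g p w (e i p)" for i w
  proof -
    let ?x = "\<chi> j. g p w (e j p)" and ?I = "mat 1 :: real ^ 'n ^ 'n"
    have row: "row k ?I = axis k 1" for k by (simp add: row_def mat_def axis_def vec_eq_iff)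
    have "(\<chi> k j. g p (((\<lambda>j. e j p)(i := w)) k) (e j p))
        = (\<chi> k. if k = i then \<Sum>k\<in>UNIV. ?x $ k *s row k ?I else row k ?I)"
      using on U(2) by (auto simp: vec_eq_iff row axis_def if_distrib cong: if_cong)
    then show ?thesis
      unfolding frame_form_def by (simp only: cramer_lemma_transpose) simp
  qed
  have "cov_deriv_top D (frame_form e) X e p = \<alpha> p (X p) * frame_form e p (\<lambda>i. e i p)"
    using koszul frame_form_volume_form[OF U(1) e on] oU W XW eW
    unfolding first_koszul_form_def by blast
  moreover have "D X (e i) p = N X (e i) p" for i
    using same[unfolded same_connection_def, rule_format, OF W(1) XW eW W(4)] .
  ultimately show ?thesis
    using one[of "\<lambda>q. frame_form e q (\<lambda>i. e i q)"] frame1 W(4)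
    by (simp add: cov_deriv_top_def sub skew)
qed

end

theorem corollary4p9:
  fixes A :: "('a::{t2_space,second_countable_topology}, 'n::finite) atlas"
    and D nabla :: "'a conn"
    and g :: "'a metric_field"
    and \<alpha> :: "'a oneform"
    and f :: "'a \<Rightarrow> real"
    and l :: real
  assumes compact: "compact (UNIV :: 'a set)"
    and levi_civita: "levi_civita A g nabla"
    and koszul: "first_koszul_form A D g \<alpha>"
    and soliton: "gradient_hesse_soliton A D g nabla \<alpha> f l"
    and nontrivial: "\<not> hesse_einstein A D g \<alpha>"
  shows "proper_hessian A D nabla"
  unfolding proper_hessian_def
proof
  assume same: "same_connection A D nabla"
  have hessian: "hessian_manifold A D g" using soliton by (simp add: gradient_hesse_soliton_def)
  interpret riemannian_manifold A g
    using hessian by unfold_locales (simp_all add: hessian_manifold_def)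
  have conn: "connection A D" using hessian by (simp add: hessian_manifold_def flat_connection_def)
  note zero = first_koszul_form_levi_civita[OF levi_civita koszul same]
  \<comment> \<open>Since \<beta> vanishes, the Hesse-Einstein constant is 0, contradicting
    nontriviality.\<close>
  have "tensor2_eq_on A UNIV (second_koszul_form D \<alpha>) (\<lambda>X Y p. 0 * metric_tensor g X Y p)"
    unfolding tensor2_eq_on_def
  proof (intro allI impI ballI; elim conjE)
    fix U X Y p
    assume U: "open U" and X: "X \<in> vfields A U" and Y: "Y \<in> vfields A U" and p: "p \<in> U"
    have "D X Y \<in> vfields A U"
      using conn[unfolded connection_def, rule_format, OF U, THEN conjunct1] X Y by blast
    then have "\<alpha> p (D X Y p) = 0" by (rule zero[OF U _ p])
    \<comment> \<open>Differentiating \<alpha>(Y) at p requires its vanishing on all of U, not just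
      at p.\<close>
    moreover have "X p (\<lambda>q. 0) = X p (\<lambda>q. \<alpha> q (Y q))"
      by (rule tangent_cong_open[OF vfieldsD[OF X p] U p smooth_fun_const[OF U]])
        (simp add: zero[OF U Y])
    ultimately show "second_koszul_form D \<alpha> X Y p = 0 * metric_tensor g X Y p"
      using tangent_const[OF vfieldsD[OF X p], of 0]
      by (simp add: second_koszul_form_def cov_deriv_form_def)
  qed
  then show False using nontrivial unfolding hesse_einstein_def by blast
qed

end
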